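(* Let $G$ be a quantum graph (undirected and loopless) with vertex quantum set $V(G)=\bigoplus_{i=1}^k M_{n_i}\subseteq B(H)=M_n$, where $H=\bigoplus_{i=1}^k\mathbb{C}^{n_i}$ and $n=\sum_i n_i$. Let $A_G$ be its adjacency operator and $S\subseteq M_n$ its corresponding operator space. Then the following are equivalent. 1. $G$ is not CGW connected: there exists a non-trivial projection $p\in V(G)$ (that is, $p\neq 0$ and $p\neq 1$) such that $L_pA_GL_{p^\perp}=0$, where $L_a$ denotes left multiplication by $a$ on $V(G)$ and $p^\perp=1-p$. 2. $G$ is not connected in the sense of Chávez-Domínguez and Swift: $(S+\mathbb{C}I)^m\neq M_n$ for all $m\in\mathbb{N}$. 3. $G$ is not connected in the sense of Matsuda: there exists a surjective graph homomorphism $G\to K_2^{c,\circ}$, where $K_2^{c,\circ}$ is the graph consisting of two vertices, each with a self-loop, and no other edges. 4. $G$ is disconnected: there exists a non-trivial projective subset $P\sqsubseteq V(G)$ such that $E(G)$ and $P\times P^c$ are disjoint.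
   Context: All Hilbert spaces are finite-dimensional; "projector" means orthogonal projector. Quantum sets. A quantum set is a special symmetric $\dagger$-Frobenius monoid in finite-dimensional Hilbert spaces; equivalently a finite-dimensional C*-algebra, up to isomorphism $X=\bigoplus_{i=1}^k M_{n_i}$ with the usual product, unit $1$ and involution, and inner product $\langle a,b\rangle=\sum_i n_i\mathrm{Tr}(a_i^*b_i)$, for which the multiplication $m:X\otimes X\to X$ satisfies $mm^\dagger=\mathrm{id}_X$. It acts block-diagonally on $H=\bigoplus_i\mathbb{C}^{n_i}$, so $X\subseteq B(H)$. The classical set of $k$ elements is $\mathbb{C}^k$ with standard basis $e_1,\dots,e_k$. Projective subsets. A projective subset $Y\sqsubseteq X$ is given by a projector $\widehat Y:X\to X$ with $\widehat Y(ab)=\widehat Y(a)b$ for all $a,b\in X$. These correspond bijectively to projections $\widetilde Y=\widehat Y(1)\in X$, via $\widehat Y(a)=\widetilde Ya$; $\widetilde Y$ is also viewed as a projector on $H$. The complement $Y^c$ has projection $1-\widetilde Y$. $Y,Z\sqsubseteq X$ are disjoint if $\mathrm{img}\,\widetilde Y\perp\mathrm{img}\,\widetilde Z$. $Y$ is non-trivial if $\widetilde Y\ne 0,1$. Cartesian products. For $V\subseteq B(H)$, the quantum set $V^{op}\otimes V$ acts on $H^*\otimes H\cong B(H)$ (identify $\langle u|\otimes|v\rangle$ with $|v\rangle\langle u|$) by $(a\otimes b)\cdot x=bxa$; thus projections in $V^{op}\otimes V$ have images in $B(H)$, which carries the Hilbert–Schmidt inner product. For $Y,Z\sqsubseteq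 V$, $Y\times Z\sqsubseteq V^{op}\otimes V$ is the projective subset whose projection acts on $B(H)$ as $x\mapsto\widetilde Zx\widetilde Y$ (i.e. as $\overline{\widetilde Y}\otimes\widetilde Z$ on $H^*\otimes H$). Quantum graphs. A quantum graph $G$ is a quantum set $V=V(G)$ with an adjacency operator $A_G:V\to V$ satisfying $m(A_G\otimes A_G)m^\dagger=A_G$ and $A_G(x^* )=A_G(x)^*$. Equivalently, it is given by its edge relation $E(G)\sqsubseteq V^{op}\otimes V$, i.e. a projector $\widehat{E(G)}$ on $V\otimes V$ with $\widehat{E(G)}(ax\otimes yb)=(a\otimes 1)\widehat{E(G)}(x\otimes y)(1\otimes b)$, related by $\widehat{E(G)}=(\mathrm{id}\otimes m)(\mathrm{id}\otimes A_G\otimes\mathrm{id})(m^\dagger\otimes\mathrm{id})$. $G$ is undirected if $A_G=A_G^\dagger$ and loopless if $m(A_G\otimes\mathrm{id})m^\dagger=0$. The corresponding operator space of $G$ is $S=\mathrm{img}\,\widetilde{E(G)}\subseteq B(H)$. For operator spaces $S,T\subseteq M_n$, $ST=\mathrm{span}\{st\mid s\in S,t\in T\}$, $S^0=\mathbb{C}I$, $S^m=SS^{m-1}$. A classical function $f:X\to Y$ between quantum sets is a linear map with $m_Y^\dagger f=(f\otimes f)m_X^\dagger$, $u_Y^\dagger f=u_X^\dagger$ (where $u$ is the unit map $\mathbb{C}\to X$), and $f(x^* )=f(x)^*$; equivalently $f^\dagger$ is a unital $*$-homomorphism. A graph homomorphism $G\to K$ of quantum graphs is a classical function $\varphi:V(G)\to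 V(K)$ with $(\varphi\otimes\varphi)(\mathrm{img}\,\widehat{E(G)})\subseteq\mathrm{img}\,\widehat{E(K)}$. $K_2^{c,\circ}$ is the quantum graph with $V=\mathbb{C}^2$ and adjacency operator $\mathrm{id}$, so $\mathrm{img}\,\widehat{E(K_2^{c,\circ})}=\mathrm{span}\{e_1\otimes e_1,e_2\otimes e_2\}$. *)

theory Defs
  imports "HOL-Analysis.Analysis"
begin

text \<open>
  The Hilbert space H of dimension n is complex^'n, so B(H) = M_n is complex^'n^'n.
  A quantum set is given by a block map \<open>\<beta> :: 'n \<Rightarrow> 'k\<close> on the standard basis of H: its nonempty
  fibres are the index sets of the summands of H, and the algebra consists of the matrices
  that are block diagonal for this partition.  Every direct sum of full matrix algebras
  of sizes n_1, ..., n_k (all positive, with sum n) arises in this way, the sizes being the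
  cardinalities of the fibres.
\<close>


subsection \<open>Complex matrices\<close>

definition cscale :: "complex \<Rightarrow> complex^'n^'m \<Rightarrow> complex^'n^'m"  (infixr \<open>*\<^sub>C\<close> 75)
  where "c *\<^sub>C x = map_matrix (\<lambda>z. c * z) x"

lemma cscale_nth [simp]: "(c *\<^sub>C x) $ i $ j = c * x $ i $ j"
  by (simp add: cscale_def)

global_interpretation cmat: vector_space "cscale :: complex \<Rightarrow> complex^'n^'m \<Rightarrow> complex^'n^'m"
  by unfold_locales (simp_all add: vec_eq_iff algebra_simps)

definition cadj :: "complex^'n^'m \<Rightarrow> complex^'m^'n"
  where "cadj x = map_matrix cnj (transpose x)"

definition munit :: "'m \<Rightarrow> 'n \<Rightarrow> complex^'n::finite^'m::finite"
  where "munit i j = (\<chi> k l. if k = i \<and> l = j then 1 else 0)"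

definition kron :: "complex^'n^'n \<Rightarrow> complex^'m^'m \<Rightarrow> complex^('n::finite \<times> 'm::finite)^('n \<times> 'm)"
  where "kron a b = (\<chi> r s. a $ fst r $ fst s * b $ snd r $ snd s)"

definition hs_inner :: "complex^'n^'n \<Rightarrow> complex^'n^'n \<Rightarrow> complex"
  where "hs_inner x y = trace (cadj x ** y)"


subsection \<open>Quantum sets\<close>

definition qset :: "('n::finite \<Rightarrow> 'k) \<Rightarrow> (complex^'n^'n) set"
  where "qset \<beta> = {x. \<forall>i j. \<beta> i \<noteq> \<beta> j \<longrightarrow> x $ i $ j = 0}"

definition block_size :: "('n::finite \<Rightarrow> 'k) \<Rightarrow> 'n \<Rightarrow> nat"
  where "block_size \<beta> i = card {j. \<beta> j = \<beta> i}"

text \<open>The inner product \<open>\<Sum>\<^sub>i n\<^sub>i Tr(a\<^sub>i\<^sup>* b\<^sub>i)\<close>, the sum over blocks and the traces being merged into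
  one sum over the basis of H.\<close>

definition qinner :: "('n::finite \<Rightarrow> 'k) \<Rightarrow> complex^'n^'n \<Rightarrow> complex^'n^'n \<Rightarrow> complex"
  where "qinner \<beta> a b = (\<Sum>i\<in>UNIV. of_nat (block_size \<beta> i) * (cadj a ** b) $ i $ i)"

text \<open>The tensor product of the quantum sets of \<open>\<beta>\<close> and \<open>\<gamma>\<close> is the quantum set of
  \<open>map_prod \<beta> \<gamma>\<close>, acting on the tensor product of the Hilbert spaces; the inner product of the
  latter quantum set is the tensor product of the inner products.\<close>

abbreviation sq :: "('n \<Rightarrow> 'k) \<Rightarrow> 'n \<times> 'n \<Rightarrow> 'k \<times> 'k"
  where "sq \<beta> \<equiv> map_prod \<beta> \<beta>"

definition clinear_on ::
    "(complex^'n^'n) set \<Rightarrow> (complex^'m^'m) set \<Rightarrow> (complex^'n^'n \<Rightarrow> complex^'m^'m) \<Rightarrow> bool"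
  where "clinear_on V W f \<longleftrightarrow>
    (\<forall>x\<in>V. f x \<in> W) \<and>
    (\<forall>x\<in>V. \<forall>y\<in>V. f (x + y) = f x + f y) \<and>
    (\<forall>c. \<forall>x\<in>V. f (c *\<^sub>C x) = c *\<^sub>C f x)"

text \<open>The adjoint of a linear map between quantum sets, expanded in the orthogonal basis of matrix
  units lying in the quantum set, each of which has squared norm its block size.\<close>

definition dagger ::
    "('n::finite \<Rightarrow> 'k) \<Rightarrow> ('m::finite \<Rightarrow> 'l) \<Rightarrow> (complex^'n^'n \<Rightarrow> complex^'m^'m) \<Rightarrow>
     complex^'m^'m \<Rightarrow> complex^'n^'n"
  where "dagger \<beta> \<gamma> f y =
    (\<Sum>(i, j)\<in>{(i, j). \<beta> i = \<beta> j}.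
       (qinner \<gamma> (f (munit i j)) y / of_nat (block_size \<beta> i)) *\<^sub>C munit i j)"

text \<open>The tensor product of f and g, linear maps defined on the quantum sets of \<open>\<beta>\<close> and \<open>\<gamma>\<close>.\<close>

definition tensor_map ::
    "('n::finite \<Rightarrow> 'k) \<Rightarrow> ('m::finite \<Rightarrow> 'l) \<Rightarrow>
     (complex^'n^'n \<Rightarrow> complex^'p^'p) \<Rightarrow> (complex^'m^'m \<Rightarrow> complex^'q^'q) \<Rightarrow>
     complex^('n \<times> 'm)^('n \<times> 'm) \<Rightarrow> complex^('p::finite \<times> 'q::finite)^('p \<times> 'q)"
  where "tensor_map \<beta> \<gamma> f g w =
    (\<Sum>(i, j)\<in>{(i, j). \<beta> i = \<beta> j}. \<Sum>(k, l)\<in>{(k, l). \<gamma> k = \<gamma> l}.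
       (w $ (i, k) $ (j, l)) *\<^sub>C kron (f (munit i j)) (g (munit k l)))"

definition qmult :: "complex^('n::finite \<times> 'n)^('n \<times> 'n) \<Rightarrow> complex^'n^'n"
  where "qmult w =
    (\<Sum>i\<in>UNIV. \<Sum>j\<in>UNIV. \<Sum>k\<in>UNIV. \<Sum>l\<in>UNIV.
       (w $ (i, k) $ (j, l)) *\<^sub>C (munit i j ** munit k l))"

definition comult :: "('n::finite \<Rightarrow> 'k) \<Rightarrow> complex^'n^'n \<Rightarrow> complex^('n \<times> 'n)^('n \<times> 'n)"
  where "comult \<beta> = dagger (sq \<beta>) \<beta> qmult"

text \<open>The adjoint of the unit map \<open>c \<mapsto> c 1\<close>.\<close>

definition counit :: "('n::finite \<Rightarrow> 'k) \<Rightarrow> complex^'n^'n \<Rightarrow> complex"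
  where "counit \<beta> x = qinner \<beta> (mat 1) x"

definition tensor_assoc ::
    "complex^(('a::finite \<times> 'b::finite) \<times> 'c::finite)^(('a \<times> 'b) \<times> 'c) \<Rightarrow>
     complex^('a \<times> ('b \<times> 'c))^('a \<times> ('b \<times> 'c))"
  where "tensor_assoc w =
    (\<chi> r s. w $ ((fst r, fst (snd r)), snd (snd r)) $ ((fst s, fst (snd s)), snd (snd s)))"

definition is_projection :: "('n::finite \<Rightarrow> 'k) \<Rightarrow> complex^'n^'n \<Rightarrow> bool"
  where "is_projection \<beta> p \<longleftrightarrow> p \<in> qset \<beta> \<and> p ** p = p \<and> cadj p = p"

definition proj_subset :: "('n::finite \<Rightarrow> 'k) \<Rightarrow> (complex^'n^'n \<Rightarrow> complex^'n^'n) \<Rightarrow> bool"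
  where "proj_subset \<beta> Y \<longleftrightarrow>
    clinear_on (qset \<beta>) (qset \<beta>) Y \<and>
    (\<forall>a\<in>qset \<beta>. Y (Y a) = Y a) \<and>
    (\<forall>a\<in>qset \<beta>. dagger \<beta> \<beta> Y a = Y a) \<and>
    (\<forall>a\<in>qset \<beta>. \<forall>b\<in>qset \<beta>. Y (a ** b) = Y a ** b)"

definition subset_proj :: "(complex^'n^'n \<Rightarrow> complex^'n^'n) \<Rightarrow> complex^'n^'n"
  where "subset_proj Y = Y (mat 1)"

definition nontrivial :: "(complex^'n^'n \<Rightarrow> complex^'n^'n) \<Rightarrow> bool"
  where "nontrivial Y \<longleftrightarrow> subset_proj Y \<noteq> 0 \<and> subset_proj Y \<noteq> mat 1"

definition compl_subset :: "(complex^'n^'n \<Rightarrow> complex^'n^'n) \<Rightarrow> complex^'n^'n \<Rightarrow> complex^'n^'n"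
  where "compl_subset Y a = a - Y a"

definition classical_function ::
    "('n::finite \<Rightarrow> 'k) \<Rightarrow> ('m::finite \<Rightarrow> 'l) \<Rightarrow> (complex^'n^'n \<Rightarrow> complex^'m^'m) \<Rightarrow> bool"
  where "classical_function \<beta> \<gamma> f \<longleftrightarrow>
    clinear_on (qset \<beta>) (qset \<gamma>) f \<and>
    (\<forall>x\<in>qset \<beta>. comult \<gamma> (f x) = tensor_map \<beta> \<beta> f f (comult \<beta> x)) \<and>
    (\<forall>x\<in>qset \<beta>. counit \<gamma> (f x) = counit \<beta> x) \<and>
    (\<forall>x\<in>qset \<beta>. f (cadj x) = cadj (f x))"


subsection \<open>The quantum set \<open>V\<^sup>o\<^sup>p \<otimes> V\<close>\<close>

text \<open>Elements of \<open>V\<^sup>o\<^sup>p \<otimes> V\<close> are written as elements of \<open>V \<otimes> V\<close>, which is the same vector space.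
  The function below extends \<open>(a \<otimes> b) \<cdot> x = b x a\<close> linearly; the first tensor factor
  therefore acts with the opposite multiplication.\<close>

definition act :: "complex^('n::finite \<times> 'n)^('n \<times> 'n) \<Rightarrow> complex^'n^'n \<Rightarrow> complex^'n^'n"
  where "act t x =
    (\<Sum>i\<in>UNIV. \<Sum>j\<in>UNIV. \<Sum>k\<in>UNIV. \<Sum>l\<in>UNIV.
       (t $ (i, k) $ (j, l)) *\<^sub>C (munit k l ** x ** munit i j))"

text \<open>Projective subsets of \<open>V\<^sup>o\<^sup>p \<otimes> V\<close> enter below through their projections in \<open>V\<^sup>o\<^sup>p \<otimes> V\<close>.
  The projection of \<open>Y \<times> Z\<close> acts on B(H) by \<open>x \<mapsto> z x y\<close>, where y and z are the projections of
  Y and Z.\<close>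

definition times_proj ::
    "(complex^'n^'n \<Rightarrow> complex^'n^'n) \<Rightarrow> (complex^'n^'n \<Rightarrow> complex^'n^'n) \<Rightarrow>
     complex^('n::finite \<times> 'n)^('n \<times> 'n)"
  where "times_proj Y Z = kron (subset_proj Y) (subset_proj Z)"

definition disjoint_rel ::
    "complex^('n::finite \<times> 'n)^('n \<times> 'n) \<Rightarrow> complex^('n \<times> 'n)^('n \<times> 'n) \<Rightarrow> bool"
  where "disjoint_rel s t \<longleftrightarrow> (\<forall>x\<in>range (act s). \<forall>y\<in>range (act t). hs_inner x y = 0)"


subsection \<open>Quantum graphs\<close>

definition quantum_graph :: "('n::finite \<Rightarrow> 'k) \<Rightarrow> (complex^'n^'n \<Rightarrow> complex^'n^'n) \<Rightarrow> bool"
  where "quantum_graph \<beta> A \<longleftrightarrow>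
    clinear_on (qset \<beta>) (qset \<beta>) A \<and>
    (\<forall>x\<in>qset \<beta>. qmult (tensor_map \<beta> \<beta> A A (comult \<beta> x)) = A x) \<and>
    (\<forall>x\<in>qset \<beta>. A (cadj x) = cadj (A x))"

definition undirected :: "('n::finite \<Rightarrow> 'k) \<Rightarrow> (complex^'n^'n \<Rightarrow> complex^'n^'n) \<Rightarrow> bool"
  where "undirected \<beta> A \<longleftrightarrow> (\<forall>x\<in>qset \<beta>. dagger \<beta> \<beta> A x = A x)"

definition loopless :: "('n::finite \<Rightarrow> 'k) \<Rightarrow> (complex^'n^'n \<Rightarrow> complex^'n^'n) \<Rightarrow> bool"
  where "loopless \<beta> A \<longleftrightarrow> (\<forall>x\<in>qset \<beta>. qmult (tensor_map \<beta> \<beta> A id (comult \<beta> x)) = 0)"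

text \<open>The operator \<open>(id \<otimes> m) (id \<otimes> A \<otimes> id) (m\<^sup>\<dagger> \<otimes> id)\<close> on \<open>V \<otimes> V\<close>.\<close>

definition edge_op ::
    "('n::finite \<Rightarrow> 'k) \<Rightarrow> (complex^'n^'n \<Rightarrow> complex^'n^'n) \<Rightarrow>
     complex^('n \<times> 'n)^('n \<times> 'n) \<Rightarrow> complex^('n \<times> 'n)^('n \<times> 'n)"
  where "edge_op \<beta> A =
    tensor_map \<beta> (sq \<beta>) id qmult \<circ>
    tensor_map \<beta> (sq \<beta>) id (tensor_map \<beta> \<beta> A id) \<circ>
    tensor_assoc \<circ>
    tensor_map \<beta> \<beta> (comult \<beta>) id"

definition edge_img ::
    "('n::finite \<Rightarrow> 'k) \<Rightarrow> (complex^'n^'n \<Rightarrow> complex^'n^'n) \<Rightarrow> (complex^('n \<times> 'n)^('n \<times> 'n)) set"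
  where "edge_img \<beta> A = edge_op \<beta> A ` qset (sq \<beta>)"

definition edge_proj ::
    "('n::finite \<Rightarrow> 'k) \<Rightarrow> (complex^'n^'n \<Rightarrow> complex^'n^'n) \<Rightarrow> complex^('n \<times> 'n)^('n \<times> 'n)"
  where "edge_proj \<beta> A = edge_op \<beta> A (kron (mat 1) (mat 1))"

definition op_space ::
    "('n::finite \<Rightarrow> 'k) \<Rightarrow> (complex^'n^'n \<Rightarrow> complex^'n^'n) \<Rightarrow> (complex^'n^'n) set"
  where "op_space \<beta> A = range (act (edge_proj \<beta> A))"

definition graph_hom ::
    "('n::finite \<Rightarrow> 'k) \<Rightarrow> (complex^'n^'n \<Rightarrow> complex^'n^'n) \<Rightarrow>
     ('m::finite \<Rightarrow> 'l) \<Rightarrow> (complex^'m^'m \<Rightarrow> complex^'m^'m) \<Rightarrow>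
     (complex^'n^'n \<Rightarrow> complex^'m^'m) \<Rightarrow> bool"
  where "graph_hom \<beta> A \<gamma> B \<phi> \<longleftrightarrow>
    classical_function \<beta> \<gamma> \<phi> \<and> tensor_map \<beta> \<beta> \<phi> \<phi> ` edge_img \<beta> A \<subseteq> edge_img \<gamma> B"

text \<open>The two vertices with a loop at each and no other edges: the classical set of two elements
  (diagonal 2 by 2 matrices), with the identity as adjacency operator.\<close>

definition two_blocks :: "2 \<Rightarrow> 2"
  where "two_blocks = id"

definition two_loops :: "complex^2^2 \<Rightarrow> complex^2^2"
  where "two_loops = id"


subsection \<open>Operator spaces\<close>

definition op_prod :: "(complex^'n^'n) set \<Rightarrow> (complex^'n^'n) set \<Rightarrow> (complex^'n::finite^'n) set"
  where "op_prod S T = cmat.span {s ** t | s t. s \<in> S \<and> t \<in> T}"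

primrec op_power :: "(complex^'n^'n) set \<Rightarrow> nat \<Rightarrow> (complex^'n::finite^'n) set"
  where
    "op_power S 0 = range mat"
  | "op_power S (Suc m) = op_prod S (op_power S m)"

definition plus_scalars :: "(complex^'n^'n) set \<Rightarrow> (complex^'n::finite^'n) set"
  where "plus_scalars S = {s + mat c | s c. s \<in> S}"


subsection \<open>Notions of connectedness\<close>

definition cgw_connected :: "('n::finite \<Rightarrow> 'k) \<Rightarrow> (complex^'n^'n \<Rightarrow> complex^'n^'n) \<Rightarrow> bool"
  where "cgw_connected \<beta> A \<longleftrightarrow>
    \<not> (\<exists>p. is_projection \<beta> p \<and> p \<noteq> 0 \<and> p \<noteq> mat 1 \<and>
          (\<forall>x\<in>qset \<beta>. p ** A ((mat 1 - p) ** x) = 0))"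

definition cds_connected :: "('n::finite \<Rightarrow> 'k) \<Rightarrow> (complex^'n^'n \<Rightarrow> complex^'n^'n) \<Rightarrow> bool"
  where "cds_connected \<beta> A \<longleftrightarrow> (\<exists>m. op_power (plus_scalars (op_space \<beta> A)) m = UNIV)"

definition matsuda_connected :: "('n::finite \<Rightarrow> 'k) \<Rightarrow> (complex^'n^'n \<Rightarrow> complex^'n^'n) \<Rightarrow> bool"
  where "matsuda_connected \<beta> A \<longleftrightarrow>
    \<not> (\<exists>\<phi>. graph_hom \<beta> A two_blocks two_loops \<phi> \<and> \<phi> ` qset \<beta> = qset two_blocks)"

definition disconnected :: "('n::finite \<Rightarrow> 'k) \<Rightarrow> (complex^'n^'n \<Rightarrow> complex^'n^'n) \<Rightarrow> bool"
  where "disconnected \<beta> A \<longleftrightarrow>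
    (\<exists>P. proj_subset \<beta> P \<and> nontrivial P \<and>
         disjoint_rel (edge_proj \<beta> A) (times_proj P (compl_subset P)))"

subsection \<open>The coordinate definitions have their intended characterizations\<close>

text \<open>The characterizations are \<open>qmult_kron\<close>, \<open>tensor_assoc_kron\<close>, \<open>act_kron\<close>, \<open>tensor_map_kron\<close>,
  \<open>dagger_adjoint\<close> and \<open>qmult_comult\<close> (the last is \<open>m m\<^sup>\<dagger> = id\<close>).\<close>

lemma munit_nth: "munit i j $ k $ l = (if k = i \<and> l = j then 1 else 0)"
  by (simp add: munit_def)

lemma sum_matrix_nth: "(\<Sum>a\<in>S. f a :: complex^'n^'m) $ i $ j = (\<Sum>a\<in>S. f a $ i $ j)"
  by (simp add: sum_component)

lemma munit_mult: "munit i j ** munit k l = (if j = k then munit i l else (0::complex^'c::finite^'a::finite))"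
proof -
  have "(munit i j ** munit k l) $ a $ b = (if j = k then munit i l else (0::complex^'c^'a)) $ a $ b" for a b
  proof -
    have "(munit i j ** munit k l :: complex^'c^'a) $ a $ b = (\<Sum>c\<in>UNIV. if c = j then (if a = i \<and> j = k \<and> b = l then 1 else 0) else 0)"
      unfolding matrix_matrix_mult_def vec_lambda_beta by (rule sum.cong) (auto simp: munit_nth)
    then show ?thesis by (simp add: munit_nth)
  qed
  then show ?thesis by (simp add: vec_eq_iff)
qed

lemma qmult_nth: "qmult w $ i $ l = (\<Sum>j\<in>UNIV. w $ (i, j) $ (j, l))"
proof -
  have "qmult w $ i $ l = (\<Sum>a\<in>UNIV. \<Sum>b\<in>UNIV. \<Sum>c\<in>UNIV. \<Sum>d\<in>UNIV.
     if d = l then if c = b then if a = i then w $ (a, c) $ (b, d) else 0 else 0 else 0)"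
    unfolding qmult_def sum_matrix_nth by (intro sum.cong refl) (auto simp: munit_mult munit_nth)
  also have "\<dots> = (\<Sum>a\<in>UNIV. if a = i then \<Sum>b\<in>UNIV. w $ (a, b) $ (b, l) else 0)"
    by (intro sum.cong refl) simp
  also have "\<dots> = (\<Sum>j\<in>UNIV. w $ (i, j) $ (j, l))"
    by simp
  finally show ?thesis .
qed

lemma qmult_kron: "qmult (kron a b) = a ** b"
  by (simp add: vec_eq_iff qmult_nth kron_def matrix_matrix_mult_def)

lemma tensor_assoc_kron: "tensor_assoc (kron (kron a b) c) = kron a (kron b c)"
  by (simp add: vec_eq_iff tensor_assoc_def kron_def)

lemma act_nth: "act t x $ k $ j = (\<Sum>l\<in>UNIV. \<Sum>i\<in>UNIV. t $ (i, k) $ (j, l) * x $ l $ i)"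
proof -
  have m: "(munit c d ** x ** munit a b) $ k $ j = (if c = k then if b = j then x $ d $ a else 0 else 0)"
    for a b c d
    by (cases "c = k"; cases "b = j";
        simp add: matrix_matrix_mult_def munit_nth mult_delta_left mult_delta_right)
  have "act t x $ k $ j = (\<Sum>a\<in>UNIV. \<Sum>b\<in>UNIV. \<Sum>c\<in>UNIV. \<Sum>d\<in>UNIV.
     if c = k then if b = j then t $ (a,c) $ (b,d) * x $ d $ a else 0 else 0)"
    unfolding act_def sum_matrix_nth by (intro sum.cong refl) (auto simp: m)
  also have "\<dots> = (\<Sum>a\<in>UNIV. \<Sum>b\<in>UNIV. if b = j then \<Sum>d\<in>UNIV. t $ (a,k) $ (b,d) * x $ d $ a else 0)"
    apply (intro sum.cong refl)
    subgoal for a b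
      by (subst sum.swap) (cases "b = j"; simp add: sum.delta sum.delta')
    done
  also have "\<dots> = (\<Sum>a\<in>UNIV. \<Sum>d\<in>UNIV. t $ (a,k) $ (j,d) * x $ d $ a)"
    by (simp add: sum.delta sum.delta')
  finally show ?thesis by (subst sum.swap)
qed

lemma act_kron: "act (kron a b) x = b ** x ** a"
proof -
  have "act (kron a b) x $ k $ j = (b ** x ** a) $ k $ j" for k j
  proof -
    have "act (kron a b) x $ k $ j = (\<Sum>i\<in>UNIV. \<Sum>l\<in>UNIV. b $ k $ l * x $ l $ i * a $ i $ j)"
      unfolding act_nth kron_def by (subst sum.swap) (simp add: mult_ac)
    then show ?thesis
      by (simp add: matrix_matrix_mult_def sum_distrib_right)
  qed
  then show ?thesis by (simp add: vec_eq_iff)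
qed

lemma block_size_nonzero: "block_size \<beta> i \<noteq> 0"
  unfolding block_size_def by (subst card_0_eq) auto

lemma qset_expand:
  assumes "x \<in> qset \<beta>"
  shows "x = (\<Sum>(i, j)\<in>{(i, j). \<beta> i = \<beta> j}. (x $ i $ j) *\<^sub>C munit i j)"
proof -
  have "(\<Sum>(i, j)\<in>{(i, j). \<beta> i = \<beta> j}. (x $ i $ j) *\<^sub>C munit i j) $ a $ b = x $ a $ b" for a b
  proof -
    have "(\<Sum>(i, j)\<in>{(i, j). \<beta> i = \<beta> j}. (x $ i $ j) *\<^sub>C munit i j) $ a $ b
      = (\<Sum>p\<in>{(i, j). \<beta> i = \<beta> j}. if p = (a, b) then x $ a $ b else 0)"
      unfolding sum_matrix_nth by (intro sum.cong refl) (auto simp: munit_nth split: prod.splits)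
    also have "\<dots> = x $ a $ b"
      using assms by (subst sum.delta) (auto simp: qset_def)
    finally show ?thesis .
  qed
  then show ?thesis by (simp add: vec_eq_iff)
qed

lemma munit_qset: "munit i j \<in> qset \<beta> \<longleftrightarrow> \<beta> i = \<beta> j"
  by (auto simp: qset_def munit_nth)

lemma clinear_on_sum:
  assumes f: "clinear_on (qset \<beta>) W f" and fin: "finite S" and "\<And>a. a \<in> S \<Longrightarrow> g a \<in> qset \<beta>"
  shows "f (\<Sum>a\<in>S. c a *\<^sub>C g a) = (\<Sum>a\<in>S. c a *\<^sub>C f (g a)) \<and> (\<Sum>a\<in>S. c a *\<^sub>C g a) \<in> qset \<beta>"
  using fin assms(3)
proof (induction S)
  case empty
  have "(0::complex^'a^'a) \<in> qset \<beta>" by (simp add: qset_def)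
  moreover from this have "f (0 *\<^sub>C 0) = 0 *\<^sub>C f 0" using f unfolding clinear_on_def by blast
  ultimately show ?case by simp
next
  case (insert a S)
  have "c a *\<^sub>C g a \<in> qset \<beta>" using insert by (simp add: qset_def)
  moreover have "x + y \<in> qset \<beta>" if "x \<in> qset \<beta>" "y \<in> qset \<beta>" for x y
    using that by (auto simp: qset_def)
  ultimately show ?case using insert f by (simp add: clinear_on_def)
qed

lemma clinear_on_expand:
  assumes f: "clinear_on (qset \<beta>) W f" and "x \<in> qset \<beta>"
  shows "f x = (\<Sum>(i, j)\<in>{(i, j). \<beta> i = \<beta> j}. (x $ i $ j) *\<^sub>C f (munit i j))"
proof -
  have "f x = f (\<Sum>(i, j)\<in>{(i, j). \<beta> i = \<beta> j}. (x $ i $ j) *\<^sub>C munit i j)"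
    using qset_expand[OF assms(2)] by simp
  also have "\<dots> = (\<Sum>(i, j)\<in>{(i, j). \<beta> i = \<beta> j}. (x $ i $ j) *\<^sub>C f (munit i j))"
    using clinear_on_sum[OF f, of "{(i, j). \<beta> i = \<beta> j}" "\<lambda>(i,j). munit i j" "\<lambda>(i,j). x $ i $ j"]
    by (auto simp: munit_qset case_prod_unfold)
  finally show ?thesis .
qed

lemma tensor_map_kron:
  assumes "clinear_on (qset \<beta>) V f" "clinear_on (qset \<gamma>) W g" "a \<in> qset \<beta>" "b \<in> qset \<gamma>"
  shows "tensor_map \<beta> \<gamma> f g (kron a b) = kron (f a) (g b)"
  unfolding clinear_on_expand[OF assms(1,3)] clinear_on_expand[OF assms(2,4)] tensor_map_def
  by (simp add: vec_eq_iff sum_matrix_nth kron_def case_prod_unfold sum_product mult_ac)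

lemma qinner_eq:
  "qinner \<gamma> x y = (\<Sum>i\<in>UNIV. \<Sum>k\<in>UNIV. of_nat (block_size \<gamma> i) * (cnj (x $ k $ i) * y $ k $ i))"
  by (simp add: qinner_def matrix_matrix_mult_def cadj_def transpose_def sum_distrib_left)

lemma qinner_sum: "qinner \<gamma> (\<Sum>a\<in>S. c a *\<^sub>C g a) y = (\<Sum>a\<in>S. cnj (c a) * qinner \<gamma> (g a) y)"
proof (induction S rule: infinite_finite_induct)
  case (insert a S)
  have "qinner \<gamma> (c *\<^sub>C u + v) y = cnj c * qinner \<gamma> u y + qinner \<gamma> v y" for c u v
    by (simp add: qinner_eq distrib_right distrib_left sum.distrib sum_distrib_left mult.left_commute mult.assoc)
  then show ?case using insert by simp
qed (simp_all add: qinner_eq)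

lemma qinner_munit: "qinner \<beta> (munit i j) z = of_nat (block_size \<beta> j) * z $ i $ j"
proof -
  have "(\<Sum>k\<in>UNIV. of_nat (block_size \<beta> l) * (cnj (munit i j $ k $ l) * z $ k $ l)) =
      (if l = j then of_nat (block_size \<beta> j) * z $ i $ j else 0)" for l
  proof -
    have "cnj (munit i j $ k $ l) = (if k = i then if l = j then 1 else 0 else 0)" for k
      by (simp add: munit_nth)
    then show ?thesis by (cases "l = j"; simp add: mult_delta_left mult_delta_right)
  qed
  then show ?thesis by (simp add: qinner_eq)
qed

lemma dagger_adjoint:
  assumes f: "clinear_on (qset \<beta>) W f" and x: "x \<in> qset \<beta>"
  shows "qinner \<beta> x (dagger \<beta> \<gamma> f y) = qinner \<gamma> (f x) y"
proof -
  note nz = block_size_nonzero[of \<beta>]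
  have bs: "block_size \<beta> j = block_size \<beta> i" if "\<beta> i = \<beta> j" for i j
    using that by (simp add: block_size_def)
  have d: "dagger \<beta> \<gamma> f y $ i $ j = (if \<beta> i = \<beta> j then qinner \<gamma> (f (munit i j)) y / of_nat (block_size \<beta> i) else 0)" for i j
  proof -
    have "dagger \<beta> \<gamma> f y $ i $ j = (\<Sum>p\<in>{(i, j). \<beta> i = \<beta> j}. if p = (i, j) then qinner \<gamma> (f (munit i j)) y / of_nat (block_size \<beta> i) else 0)"
      unfolding dagger_def sum_matrix_nth by (intro sum.cong refl) (auto simp: munit_nth split: prod.splits)
    also have "\<dots> = (if \<beta> i = \<beta> j then qinner \<gamma> (f (munit i j)) y / of_nat (block_size \<beta> i) else 0)"
      by (subst sum.delta) auto
    finally show ?thesis .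
  qed
  have "qinner \<beta> x (dagger \<beta> \<gamma> f y) = (\<Sum>p\<in>{(i, j). \<beta> i = \<beta> j}. cnj (x $ fst p $ snd p) * qinner \<beta> (munit (fst p) (snd p)) (dagger \<beta> \<gamma> f y))"
    by (subst qset_expand[OF x]) (simp add: case_prod_unfold qinner_sum)
  also have "\<dots> = (\<Sum>p\<in>{(i, j). \<beta> i = \<beta> j}. cnj (x $ fst p $ snd p) * qinner \<gamma> (f (munit (fst p) (snd p))) y)"
  proof (intro sum.cong refl)
    fix p assume "p \<in> {(i, j). \<beta> i = \<beta> j}"
    then have e: "\<beta> (fst p) = \<beta> (snd p)" by auto
    then show "cnj (x $ fst p $ snd p) * qinner \<beta> (munit (fst p) (snd p)) (dagger \<beta> \<gamma> f y) =
        cnj (x $ fst p $ snd p) * qinner \<gamma> (f (munit (fst p) (snd p))) y"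
      using nz[of "fst p"] bs[OF e] by (simp add: qinner_munit d)
  qed
  also have "\<dots> = qinner \<gamma> (f x) y"
    by (subst clinear_on_expand[OF f x]) (simp add: case_prod_unfold qinner_sum)
  finally show ?thesis .
qed

lemma comult_nth:
  "comult \<beta> x $ (a,b) $ (c,d) = (if \<beta> a = \<beta> c \<and> \<beta> b = \<beta> d \<and> b = c then x $ a $ d / of_nat (block_size \<beta> a) else 0)"
proof -
  note nz = block_size_nonzero[of \<beta>]
  have bs2: "block_size (sq \<beta>) (i,j) = block_size \<beta> i * block_size \<beta> j" for i j
  proof -
    have "{p. sq \<beta> p = sq \<beta> (i,j)} = {k. \<beta> k = \<beta> i} \<times> {k. \<beta> k = \<beta> j}" by auto
    then show ?thesis by (simp add: block_size_def card_cartesian_product)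
  qed
  have bs: "block_size \<beta> j = block_size \<beta> i" if "\<beta> i = \<beta> j" for i j
    using that by (simp add: block_size_def)
  have m: "qmult (munit (i,k) (j,l)) = (if j = k then munit i l else 0)" for i j k l :: 'a
  proof -
    have "munit (i,k) (j,l) = kron (munit i j) (munit k l)"
      by (auto simp: vec_eq_iff kron_def munit_nth)
    then show ?thesis by (simp add: qmult_kron munit_mult)
  qed
  have z: "qinner \<beta> 0 x = 0" using qinner_sum[of \<beta> "\<lambda>_. 0" "\<lambda>_. 0" "{}"] by simp
  have "comult \<beta> x $ (a,b) $ (c,d) = (\<Sum>p\<in>{(i, j). sq \<beta> i = sq \<beta> j}. if p = ((a,b),(c,d)) then qinner \<beta> (qmult (munit (a,b) (c,d))) x / of_nat (block_size (sq \<beta>) (a,b)) else 0)"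
    unfolding comult_def dagger_def sum_matrix_nth by (intro sum.cong refl) (auto simp: munit_nth split: prod.splits)
  also have "\<dots> = (if sq \<beta> (a,b) = sq \<beta> (c,d) then qinner \<beta> (qmult (munit (a,b) (c,d))) x / of_nat (block_size (sq \<beta>) (a,b)) else 0)"
    by (subst sum.delta) auto
  also have "\<dots> = (if \<beta> a = \<beta> c \<and> \<beta> b = \<beta> d \<and> b = c then x $ a $ d / of_nat (block_size \<beta> a) else 0)"
    using nz bs[of b d] by (auto simp: m z qinner_munit bs2)
  finally show ?thesis .
qed

lemma qmult_comult:
  assumes "x \<in> qset \<beta>" shows "qmult (comult \<beta> x) = x"
proof -
  note nz = block_size_nonzero[of \<beta>]
  have "qmult (comult \<beta> x) $ a $ d = x $ a $ d" for a d
  proof -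
    have 0: "x $ a $ d = 0" if "\<beta> a \<noteq> \<beta> d" using assms that by (simp add: qset_def)
    have "qmult (comult \<beta> x) $ a $ d =
        (\<Sum>j\<in>UNIV. if \<beta> j = \<beta> a then x $ a $ d / of_nat (block_size \<beta> a) else 0)"
      unfolding qmult_nth comult_nth by (intro sum.cong refl) (auto simp: 0)
    also have "\<dots> = (\<Sum>j\<in>{j. \<beta> j = \<beta> a}. x $ a $ d / of_nat (block_size \<beta> a))"
      by (simp add: sum.If_cases)
    also have "\<dots> = x $ a $ d" using nz by (simp add: block_size_def)
    finally show ?thesis .
  qed
  then show ?thesis by (simp add: vec_eq_iff)
qed

end

theory Submission
  imports Defs "HOL-Computational_Algebra.Fundamental_Theorem_Algebra"
begin

text \<open>
Write \<open>S\<close> for the operator space of the graph and call a non-trivial projection of the vertex algebra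
\<open>V\<close> separating if it commutes with every element of \<open>S\<close>.  Each of the four conditions turns out to say
that a separating projection exists.

The space \<open>S\<close> is the range of \<open>x \<mapsto> \<Sum> (1/n) A(e\<^sub>j\<^sub>i) x e\<^sub>i\<^sub>j\<close>, where the sum is over the matrix units
lying in \<open>V\<close> and \<open>n\<close> is the size of the block of \<open>i\<close>.  Sandwiching this operator between \<open>r\<close> on the left
and \<open>p\<close> on the right, and testing it on matrix units, recovers all entries of the elements
\<open>r A(p e\<^sub>j\<^sub>i)\<close>.  So \<open>r S p = 0\<close> is the same as \<open>r A(p x) = 0\<close> for all \<open>x\<close> in \<open>V\<close>
(\<open>sandwich_op_space_iff\<close>).  An undirected graph has \<open>S = S\<^sup>*\<close> (\<open>cadj_op_space\<close>); hence for a projection \<open>p\<close>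
the vanishing of one of the two off-diagonal corners \<open>(1-p) S p\<close> and \<open>p S (1-p)\<close> forces that of the
other and means that \<open>p\<close> commutes with \<open>S\<close>.  The condition on \<open>L\<^sub>p A L\<^sub>1\<^sub>-\<^sub>p\<close> is the vanishing of one
corner, and disjointness of the edge relation from \<open>P \<times> P\<^sup>c\<close> is the vanishing of the other.

For surjective homomorphisms to the graph with two isolated loops, the point is that classical functions
from \<open>V\<close> to a classical set are exactly the maps
\<open>x \<mapsto> (\<langle>r\<^sub>e, x\<rangle>)\<^sub>e\<close> given by a family of orthogonal projections \<open>r\<^sub>e\<close> in \<open>V\<close> with sum \<open>1\<close>.  Such a map is
surjective when no \<open>r\<^sub>e\<close> vanishes, and it is a homomorphism when \<open>r\<^sub>e\<^sub>' A(r\<^sub>e x) = 0\<close> for \<open>e \<noteq> e'\<close>.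
For two points the family is \<open>p, 1 - p\<close>.

The condition on the powers of \<open>S + \<complex>1\<close> needs the double commutant idea.  A separating projection commutes with all
these powers, so none of them is the full matrix algebra.  Conversely, let there be no separating
projection.  Matrices commuting with all block projections are the elements of \<open>V\<close>; so no non-trivial projection,
and by the spectral argument \<open>spectral_projection_exists\<close> no non-scalar matrix, commutes with both \<open>S\<close> and
the block projections.  The span \<open>I\<close> of all non-empty products of elements of \<open>S\<close> is stable under left
multiplication by \<open>S\<close> and by the block projections.  The orthogonal projection onto \<open>I\<close> commutes with these
left multiplications, so it must be a right multiplication (\<open>left_module_is_left_ideal\<close>); hence \<open>I\<close> is
a left ideal of the full matrix algebra, generated by a projection \<open>q\<close>.  This \<open>q\<close> commutes with \<open>S\<close> and the block projections,
so \<open>q = 1\<close>, and everything is a combination of products of elements of \<open>S\<close>, or \<open>q = 0\<close>, and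
\<open>S = 0\<close>.  In the latter case every coordinate projection commutes with \<open>S\<close>, so \<open>H\<close> has dimension one and the scalars are
the full matrix algebra.
\<close>

section \<open>Complex matrices and the Hilbert-Schmidt inner product\<close>

lemma cadj_nth [simp]: "cadj x $ i $ j = cnj (x $ j $ i)"
  by (simp add: cadj_def transpose_def)

lemma mat_nth: "mat c $ i $ j = (if i = j then c else 0)"
  by (simp add: mat_def)

lemma matrix_mult_nth: "(x ** y) $ i $ j = (\<Sum>k\<in>UNIV. x $ i $ k * y $ k $ j)"
  by (simp add: matrix_matrix_mult_def)

lemma cadj_cadj [simp]: "cadj (cadj x) = x"
  by (simp add: vec_eq_iff)

lemma cadj_mult: "cadj (x ** y) = cadj y ** cadj x"
  by (simp add: vec_eq_iff matrix_mult_nth mult.commute)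

lemma cadj_add: "cadj (x + y) = cadj x + cadj y"
  and cadj_diff: "cadj (x - y) = cadj x - cadj y"
  and cadj_cscale: "cadj (c *\<^sub>C x) = cnj c *\<^sub>C cadj x"
  by (simp_all add: vec_eq_iff)

lemma cadj_0 [simp]: "cadj 0 = 0"
  by (simp add: vec_eq_iff)

lemma cadj_1 [simp]: "cadj (mat 1) = mat 1"
  by (simp add: vec_eq_iff mat_nth)

lemma cadj_munit [simp]: "cadj (munit i j) = munit j i"
  by (auto simp: vec_eq_iff munit_nth)

lemma matrix_add_rdistrib: "(x + y) ** z = x ** z + y ** (z :: complex^'a^'b)"
  by (simp add: vec_eq_iff matrix_mult_nth distrib_right sum.distrib)

lemma matrix_diff_ldistrib: "x ** (y - z) = x ** y - x ** (z :: complex^'a^'b)"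
  and matrix_diff_rdistrib: "(x' - y') ** w = x' ** w - y' ** (w :: complex^'a^'b)"
  by (simp_all add: vec_eq_iff matrix_mult_nth algebra_simps sum_subtractf)

lemma cscale_mult_left: "(c *\<^sub>C x) ** y = c *\<^sub>C (x ** y)"
  and cscale_mult_right: "x ** (c *\<^sub>C y) = c *\<^sub>C (x ** y)"
  by (simp_all add: vec_eq_iff matrix_mult_nth sum_distrib_left mult_ac)

lemma of_real_cscale: "complex_of_real c *\<^sub>C x = c *\<^sub>R x"
proof -
  have "(c *\<^sub>R x) $ i $ j = complex_of_real c * x $ i $ j" for i j
    by (simp only: vector_scaleR_component) (simp add: scaleR_conv_of_real)
  then show ?thesis by (simp add: vec_eq_iff)
qed

lemma mat_mult: "mat c ** x = c *\<^sub>C x"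
  by (simp add: vec_eq_iff matrix_mult_nth mat_nth mult_delta_left mult_delta_right)

lemma mult_mat: "x ** mat c = c *\<^sub>C x"
  by (simp add: vec_eq_iff matrix_mult_nth mat_nth mult_delta_left mult_delta_right mult.commute)

lemma mult_munit_nth: "(x ** munit i j) $ k $ l = (if l = j then x $ k $ i else 0)"
  by (simp add: matrix_mult_nth munit_nth mult_delta_right)

lemma munit_mult_nth: "(munit i j ** x) $ k $ l = (if k = i then x $ j $ l else 0)"
  by (simp add: matrix_mult_nth munit_nth mult_delta_left)

text \<open>
The full matrix algebra is a prime ring: taking matrix units for \<open>x\<close> makes the product of any entry of \<open>a\<close>
with any entry of \<open>b\<close> an entry of \<open>a x b\<close>.
\<close>

lemma matrix_eq_0_if_sandwiched:
  assumes "\<And>x. a ** x ** b = 0" and "b \<noteq> 0"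
  shows "a = (0 :: complex^'n^'n)"
proof -
  obtain i j where ij: "b $ i $ j \<noteq> 0" using \<open>b \<noteq> 0\<close> by (auto simp: vec_eq_iff)
  have "a $ k $ l * b $ i $ j = (a ** munit l i ** b) $ k $ j" for k l
    by (simp add: matrix_mult_nth[of "a ** munit l i"] mult_munit_nth mult_delta_left)
  then show ?thesis using ij by (simp add: assms(1) vec_eq_iff)
qed

lemma hs_inner_eq: "hs_inner x y = (\<Sum>i\<in>UNIV. \<Sum>k\<in>UNIV. cnj (x $ k $ i) * y $ k $ i)"
  by (simp add: hs_inner_def trace_def matrix_mult_nth)

lemma hs_inner_mult_left: "hs_inner x (c ** y) = hs_inner (cadj c ** x) y"
  by (simp add: hs_inner_def cadj_mult matrix_mul_assoc)

lemma hs_inner_munit: "hs_inner (munit i j) x = x $ i $ j"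
  by (simp add: hs_inner_def trace_def munit_mult_nth)

lemma hs_inner_self_eq_0: "hs_inner x x = 0 \<Longrightarrow> x = 0"
proof -
  assume "hs_inner x x = 0"
  moreover have "Re (hs_inner x x) = (\<Sum>i\<in>UNIV. \<Sum>k\<in>UNIV. (cmod (x $ k $ i))\<^sup>2)"
    unfolding hs_inner_eq Re_sum by (intro sum.cong refl) (simp add: cmod_power2 flip: power2_eq_square)
  ultimately have "\<forall>i k. x $ k $ i = 0"
    by (simp add: sum_nonneg_eq_0_iff sum_nonneg)
  then show "x = 0" by (simp add: vec_eq_iff)
qed

lemma inner_eq_Re_hs_inner: "inner x y = Re (hs_inner x y)"
  unfolding inner_vec_def hs_inner_eq Re_sum
  by (subst sum.swap) (simp add: inner_complex_def)

lemma hs_inner_cscale_left: "hs_inner (c *\<^sub>C x) y = cnj c * hs_inner x y"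
  by (simp add: hs_inner_eq sum_distrib_left mult_ac)

lemma hs_inner_add_right: "hs_inner x (y + z) = hs_inner x y + hs_inner x z"
  and hs_inner_diff_right: "hs_inner x (y - z) = hs_inner x y - hs_inner x z"
  and hs_inner_cscale_right: "hs_inner x (c *\<^sub>C y) = c * hs_inner x y"
  by (simp_all add: hs_inner_eq algebra_simps sum.distrib sum_subtractf sum_distrib_left)

section \<open>Orthogonal projections and one-sided ideals\<close>

text \<open>
The orthogonal decomposition for the real inner product, the real part of \<open>hs_inner\<close>, is also one for
\<open>hs_inner\<close> itself: on a complex subspace, real orthogonality to \<open>w\<close> and to \<open>\<i> w\<close> together is complex
orthogonality to \<open>w\<close>.
\<close>

lemma orthogonal_projection_exists:
  assumes "cmat.subspace W"
  shows "\<exists>y\<in>W. \<forall>w\<in>W. hs_inner w (x - y) = 0"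
proof -
  have "subspace W"
  proof (rule subspaceI)
    fix c and w assume "w \<in> W"
    then have "complex_of_real c *\<^sub>C w \<in> W" using assms cmat.subspace_scale by blast
    moreover have "complex_of_real c *\<^sub>C w = c *\<^sub>R w"
      by (rule of_real_cscale)
    ultimately show "c *\<^sub>R w \<in> W" by simp
  qed (use assms in \<open>auto intro: cmat.subspace_0 cmat.subspace_add\<close>)
  then have sp: "span W = W" by (simp add: span_eq_iff)
  obtain y z where yz: "y \<in> span W" "\<And>w. w \<in> span W \<Longrightarrow> orthogonal z w" "x = y + z"
    using orthogonal_subspace_decomp_exists by blast
  have "hs_inner w z = 0" if "w \<in> W" for w
  proof -
    have Re0: "Re (hs_inner v z) = 0" if "v \<in> W" for v
      using yz(2)[of v] that by (simp add: sp orthogonal_def inner_commute inner_eq_Re_hs_inner)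
    have "\<i> *\<^sub>C w \<in> W" using assms that cmat.subspace_scale by blast
    from Re0[OF this] Re0[OF that] show ?thesis
      by (simp add: hs_inner_cscale_left complex_eq_iff)
  qed
  moreover have "x - y = z" using yz(3) by simp
  ultimately show ?thesis using yz(1) sp by auto
qed

text \<open>
The generator is the orthogonal projection \<open>p\<close> of the identity onto the ideal.  Since \<open>w x\<close> stays in the ideal for every
\<open>x\<close>, orthogonality of \<open>1 - p\<close> to the ideal strengthens to the matrix equation \<open>w\<^sup>* (1 - p) = 0\<close>.
For \<open>w = p\<close> this equation says \<open>p = p\<^sup>* p\<close>.
\<close>

lemma right_ideal_projection:
  fixes W :: "(complex^'n^'n) set"
  assumes W: "cmat.subspace W" and ideal: "\<And>w x. w \<in> W \<Longrightarrow> w ** x \<in> W"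
  obtains p where "p \<in> W" "cadj p = p" "p ** p = p" "\<And>w. w \<in> W \<Longrightarrow> p ** w = w"
proof -
  obtain p where p: "p \<in> W" "\<And>w. w \<in> W \<Longrightarrow> hs_inner w (mat 1 - p) = 0"
    using orthogonal_projection_exists[OF W, of "mat 1"] by blast
  have "cadj w ** (mat 1 - p) = 0" if "w \<in> W" for w
  proof -
    have "(cadj w ** (mat 1 - p)) $ i $ j = 0" for i j
      using p(2)[OF ideal[OF that, of "munit i j"]]
        hs_inner_mult_left[of "munit i j" "cadj w" "mat 1 - p"] by (simp add: hs_inner_munit)
    then show ?thesis by (simp add: vec_eq_iff)
  qed
  then have *: "cadj w = cadj w ** p" if "w \<in> W" for w
    using that by (simp add: matrix_diff_ldistrib)
  then have w: "w = cadj p ** w" if "w \<in> W" for w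
    using that by (metis cadj_cadj cadj_mult)
  have sa: "cadj p = p"
    using w[OF p(1)] by (metis cadj_cadj cadj_mult)
  with w p(1) show thesis using that by metis
qed

section \<open>Spectral projections\<close>

text \<open>
Evaluation of a polynomial at a square matrix by the Horner scheme.  It is defined separately from \<open>poly\<close>
because \<open>*\<close> on the vector type is the entrywise product.
\<close>

definition poly_eval_mat :: "complex^'n^'n \<Rightarrow> complex poly \<Rightarrow> complex^'n^'n"
  where "poly_eval_mat x f = fold_coeffs (\<lambda>a y. mat a + x ** y) f 0"

lemma poly_eval_mat_0 [simp]: "poly_eval_mat x 0 = 0"
  by (simp add: poly_eval_mat_def)

lemma poly_eval_mat_pCons [simp]:
  "poly_eval_mat x (pCons a f) = mat a + x ** poly_eval_mat x f"
  by (cases "f = 0 \<and> a = 0") (auto simp: poly_eval_mat_def)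

lemma mat_add: "mat (a + b) = mat a + (mat b :: complex^'n^'n)"
  by (simp add: vec_eq_iff mat_nth)

lemma mat_times: "mat (a * b) = a *\<^sub>C (mat b :: complex^'n^'n)"
  by (simp add: vec_eq_iff mat_nth)

lemma poly_eval_mat_add: "poly_eval_mat x (f + g) = poly_eval_mat x f + poly_eval_mat x g"
  by (induction f g rule: poly_induct2) (simp_all add: mat_add matrix_add_ldistrib)

lemma poly_eval_mat_smult: "poly_eval_mat x (smult c f) = c *\<^sub>C poly_eval_mat x f"
  by (induction f) (simp_all add: mat_times cmat.scale_right_distrib cscale_mult_right)

lemma poly_eval_mat_linear_factor:
  "poly_eval_mat x ([:-c, 1:] * f) = (x - mat c) ** poly_eval_mat x f"
proof -
  have "[:-c, 1:] * f = pCons 0 f + smult (-c) f" by simp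
  then have "poly_eval_mat x ([:-c, 1:] * f) = x ** poly_eval_mat x f + (-c) *\<^sub>C poly_eval_mat x f"
    by (simp only: poly_eval_mat_add poly_eval_mat_smult poly_eval_mat_pCons mat_0 add_0)
  then show ?thesis by (simp only: matrix_diff_rdistrib mat_mult cmat.scale_minus_left) simp
qed

lemma poly_eval_mat_sum:
  "poly_eval_mat x (\<Sum>a\<in>S. f a) = (\<Sum>a\<in>S. poly_eval_mat x (f a))"
  by (induction S rule: infinite_finite_induct) (simp_all add: poly_eval_mat_add)

text \<open>
The powers of \<open>x\<close> live in a space of finite real dimension, so they are linearly dependent already over the reals.
\<close>

lemma annihilating_polynomial_exists:
  fixes x :: "complex^'n^'n"
  shows "\<exists>f. f \<noteq> 0 \<and> poly_eval_mat x f = 0"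
proof -
  define N where "N = DIM(complex^'n^'n)"
  define g where "g k = poly_eval_mat x (monom 1 k)" for k
  show ?thesis
  proof (cases "inj_on g {..N}")
    case False
    then obtain i j where ij: "i \<noteq> j" "g i = g j" by (auto simp: inj_on_def)
    have "poly_eval_mat x (monom 1 i + smult (-1) (monom 1 j)) = g i + (-1) *\<^sub>C g j"
      unfolding poly_eval_mat_add poly_eval_mat_smult g_def ..
    also have "\<dots> = 0" using ij by (simp add: vec_eq_iff)
    finally have "poly_eval_mat x (monom 1 i + smult (-1) (monom 1 j)) = 0" .
    moreover have "monom 1 i + smult (-1) (monom 1 j) \<noteq> (0 :: complex poly)"
    proof
      assume "monom 1 i + smult (-1) (monom 1 j) = (0 :: complex poly)"
      then have "coeff (monom 1 i + smult (-1) (monom 1 j)) i = (0::complex)" by simp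
      then show False using ij(1) by simp
    qed
    ultimately show ?thesis by blast
  next
    case True
    then have "card (g ` {..N}) = N + 1" by (simp add: card_image)
    then have "dependent (g ` {..N})"
      using independent_bound[of "g ` {..N}"] by (auto simp: N_def)
    then obtain u k where u: "k \<le> N" "u (g k) \<noteq> 0" "(\<Sum>v\<in>g ` {..N}. u v *\<^sub>R v) = 0"
      by (auto simp: dependent_finite)
    define f where "f = (\<Sum>j\<le>N. smult (complex_of_real (u (g j))) (monom 1 j))"
    have fk: "coeff f k = complex_of_real (u (g k))"
      using u(1) by (simp add: f_def coeff_sum mult_delta_right)
    have "poly_eval_mat x f = (\<Sum>j\<le>N. complex_of_real (u (g j)) *\<^sub>C g j)"
      by (simp add: f_def poly_eval_mat_sum poly_eval_mat_smult g_def)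
    also have "\<dots> = (\<Sum>j\<le>N. u (g j) *\<^sub>R g j)"
      by (simp add: of_real_cscale)
    also have "\<dots> = 0"
      using u(3) unfolding sum.reindex[OF True] by simp
    finally have "poly_eval_mat x f = 0" .
    moreover have "f \<noteq> 0" using fk u(2) by auto
    ultimately show ?thesis by blast
  qed
qed

text \<open>
For an annihilating polynomial \<open>f\<close> of least degree and a root \<open>c\<close>, the cofactor \<open>g\<close> in \<open>f = (X - c) g\<close>
does not annihilate \<open>x\<close>, so \<open>g(x)\<close> is the required matrix of eigenvectors.
\<close>

lemma eigenvalue_exists:
  fixes x :: "complex^'n^'n"
  obtains c and y :: "complex^'n^'n" where "y \<noteq> 0" "(x - mat c) ** y = 0"
proof -
  define P where "P f \<longleftrightarrow> f \<noteq> 0 \<and> poly_eval_mat x f = 0" for f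
  obtain f where f: "P f" and min: "\<And>g. P g \<Longrightarrow> degree f \<le> degree g"
    using annihilating_polynomial_exists[of x] ex_has_least_nat[of P _ degree]
    unfolding P_def by blast
  have "degree f \<noteq> 0"
  proof
    assume "degree f = 0"
    then obtain a where a: "f = [:a:]" by (meson degree_eq_zeroE)
    with f have "mat a = (0::complex^'n^'n)" "a \<noteq> 0" by (auto simp: P_def)
    then have "(mat a :: complex^'n^'n) $ undefined $ undefined = 0" by simp
    with \<open>a \<noteq> 0\<close> show False by (simp add: mat_nth)
  qed
  then obtain c where "poly f c = 0"
    using fundamental_theorem_of_algebra[of f] by (auto simp: constant_degree)
  then obtain g where g: "f = [:-c, 1:] * g" by (auto simp: poly_eq_0_iff_dvd)
  with f have "g \<noteq> 0" by (auto simp: P_def)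
  then have "degree f = Suc (degree g)" unfolding g by (subst degree_mult_eq) auto
  then have "\<not> P g" using min[of g] by linarith
  then have "poly_eval_mat x g \<noteq> 0" using \<open>g \<noteq> 0\<close> by (simp add: P_def)
  moreover have "(x - mat c) ** poly_eval_mat x g = 0"
    using f unfolding P_def g poly_eval_mat_linear_factor by simp
  ultimately show thesis using that by blast
qed

text \<open>
The projection \<open>p\<close> generates the right ideal of the matrices whose columns are eigenvectors for a fixed eigenvalue.
A matrix commuting with \<open>x\<close> leaves the eigenspace invariant; if its adjoint commutes with \<open>x\<close> too, it
also leaves the orthogonal complement invariant, so it commutes with \<open>p\<close>.
\<close>

lemma spectral_projection_exists:
  fixes x :: "complex^'n^'n"
  assumes nonscalar: "x \<notin> range mat"
  obtains p :: "complex^'n^'n" where "cadj p = p" "p ** p = p" "p \<noteq> 0" "p \<noteq> mat 1"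
    "\<And>c. c ** x = x ** c \<Longrightarrow> cadj c ** x = x ** cadj c \<Longrightarrow> c ** p = p ** c"
proof -
  obtain \<mu> and y :: "complex^'n^'n" where y: "y \<noteq> 0" "(x - mat \<mu>) ** y = 0"
    by (rule eigenvalue_exists)
  define W :: "(complex^'n^'n) set" where "W = {w. (x - mat \<mu>) ** w = 0}"
  have "cmat.subspace W"
    unfolding cmat.subspace_def W_def by (simp add: matrix_add_ldistrib cscale_mult_right)
  moreover have "w ** z \<in> W" if "w \<in> W" for w z
    using that by (simp add: W_def matrix_mul_assoc)
  ultimately obtain p where p: "p \<in> W" "cadj p = p" "p ** p = p" "\<And>w. w \<in> W \<Longrightarrow> p ** w = w"
    using right_ideal_projection[of W] by blast
  have "y \<in> W" using y by (simp add: W_def)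
  then have "p ** y = y" by (rule p(4))
  with y(1) have "p \<noteq> 0" by auto
  moreover have "p \<noteq> mat 1"
  proof
    assume "p = mat 1"
    then have "x = mat \<mu>" using p(1) by (simp add: W_def)
    then show False using nonscalar by blast
  qed
  moreover have "c ** p = p ** c" if c: "c ** x = x ** c" "cadj c ** x = x ** cadj c" for c
  proof -
    have *: "p ** (d ** p) = d ** p" if "d ** x = x ** d" for d
    proof (rule p(4))
      have "(x - mat \<mu>) ** d = d ** (x - mat \<mu>)"
        by (simp only: matrix_diff_ldistrib matrix_diff_rdistrib that mat_mult mult_mat)
      then have "(x - mat \<mu>) ** (d ** p) = d ** ((x - mat \<mu>) ** p)"
        unfolding matrix_mul_assoc by (rule arg_cong)
      then show "d ** p \<in> W" using p(1) by (simp add: W_def)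
    qed
    have "cadj (p ** (cadj c ** p)) = cadj (cadj c ** p)" by (simp only: *[OF c(2)])
    then have "p ** c ** p = p ** c" by (simp only: cadj_mult p(2) cadj_cadj)
    moreover have "p ** c ** p = c ** p" using *[OF c(1)] by (simp only: matrix_mul_assoc)
    ultimately show ?thesis by (rule trans[OF sym, rotated])
  qed
  ultimately show thesis by (rule that[OF p(2,3)])
qed

section \<open>Left modules over an irreducible set of matrices\<close>

lemma sum_matrix_mult: "(\<Sum>a\<in>F. f a) ** y = (\<Sum>a\<in>F. f a ** (y :: complex^'a^'b))"
  by (induction F rule: infinite_finite_induct) (simp_all add: matrix_add_rdistrib)

lemma matrix_expand: "x = (\<Sum>(i, j)\<in>UNIV. (x $ i $ j) *\<^sub>C munit i j)" for x :: "complex^'n^'n"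
  using qset_expand[of x "\<lambda>_. ()"] by (simp add: qset_def)

lemma subspace_UNIV_if_munits:
  assumes W: "cmat.subspace W" and "\<And>i j. munit i j \<in> W"
  shows "W = (UNIV :: (complex^'n^'n) set)"
proof -
  have "x \<in> W" for x
    by (subst matrix_expand[of x], rule cmat.subspace_sum[OF W])
      (auto intro: cmat.subspace_scale[OF W] assms(2))
  then show ?thesis by blast
qed

text \<open>
The orthogonal projection \<open>Q\<close> onto \<open>W\<close> commutes with left multiplication by elements of \<open>C\<close>, because \<open>C\<close> is
closed under adjoints.  Cutting \<open>Q\<close> into the blocks that send column \<open>i\<close> of a matrix to column \<open>j\<close> of the image gives matrices
commuting with \<open>C\<close>, which are scalars by irreducibility.  Therefore \<open>Q\<close> is right
multiplication by the matrix of these scalars, and its range \<open>W\<close> is a left ideal.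
\<close>

lemma left_module_is_left_ideal:
  fixes W C :: "(complex^'n^'n) set"
  assumes W: "cmat.subspace W"
    and adj: "\<And>c. c \<in> C \<Longrightarrow> cadj c \<in> C"
    and irr: "\<And>x. (\<And>c. c \<in> C \<Longrightarrow> c ** x = x ** c) \<Longrightarrow> x \<in> range mat"
    and module: "\<And>c w. c \<in> C \<Longrightarrow> w \<in> W \<Longrightarrow> c ** w \<in> W"
    and w: "w \<in> W"
  shows "x ** w \<in> W"
proof -
  obtain Q where Q: "\<And>x. Q x \<in> W" "\<And>x w. w \<in> W \<Longrightarrow> hs_inner w (x - Q x) = 0"
    using orthogonal_projection_exists[OF W] by metis
  have uniq: "Q x = y" if y: "y \<in> W" "\<And>w. w \<in> W \<Longrightarrow> hs_inner w (x - y) = 0" for x y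
  proof -
    have d: "Q x - y \<in> W" using Q(1) y(1) by (rule cmat.subspace_diff[OF W])
    have "hs_inner (Q x - y) ((x - y) - (x - Q x)) = 0"
      unfolding hs_inner_diff_right[of _ "x - y"] using y(2)[OF d] Q(2)[OF d, of x] by simp
    then have "Q x - y = 0" by (intro hs_inner_self_eq_0) simp
    then show ?thesis by simp
  qed
  have Q_mult: "Q (c ** x) = c ** Q x" if "c \<in> C" for c x
  proof (rule uniq)
    fix v assume "v \<in> W"
    then have "hs_inner (cadj c ** v) (x - Q x) = 0" using module adj[OF that] Q(2) by blast
    then show "hs_inner v (c ** x - c ** Q x) = 0"
      by (simp add: hs_inner_mult_left flip: matrix_diff_ldistrib)
  qed (use module that Q(1) in blast)
  have Q_sum: "Q (\<Sum>a\<in>F. f a *\<^sub>C g a) = (\<Sum>a\<in>F. f a *\<^sub>C Q (g a))" for F f and g :: "'z \<Rightarrow> _"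
  proof (rule uniq)
    show "(\<Sum>a\<in>F. f a *\<^sub>C Q (g a)) \<in> W"
      by (intro cmat.subspace_sum[OF W] cmat.subspace_scale[OF W] Q(1))
    fix v assume "v \<in> W"
    have "hs_inner v (\<Sum>a\<in>F. f a *\<^sub>C (g a - Q (g a))) = (\<Sum>a\<in>F. f a * hs_inner v (g a - Q (g a)))"
      by (induction F rule: infinite_finite_induct)
        (simp_all add: hs_inner_add_right hs_inner_cscale_right, simp_all add: hs_inner_eq)
    then show "hs_inner v ((\<Sum>a\<in>F. f a *\<^sub>C g a) - (\<Sum>a\<in>F. f a *\<^sub>C Q (g a))) = 0"
      using Q(2)[OF \<open>v \<in> W\<close>] by (simp add: cmat.scale_right_diff_distrib sum_subtractf)
  qed
  have "\<exists>a. \<forall>k l. Q (munit l i) $ k $ j = (if k = l then a else 0)" for i j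
  proof -
    \<comment> \<open>the block of \<open>Q\<close> from column \<open>i\<close> to column \<open>j\<close>\<close>
    define X where "X = (\<chi> k l. Q (munit l i) $ k $ j)"
    have comm: "c ** X = X ** c" if c: "c \<in> C" for c
    proof -
      have "(c ** X) $ k $ l = (X ** c) $ k $ l" for k l
      proof -
        have "c ** munit l i = (\<Sum>m\<in>UNIV. (c $ m $ l) *\<^sub>C munit m i)"
          by (simp add: vec_eq_iff sum_matrix_nth mult_munit_nth munit_nth if_distrib[of "\<lambda>x. _ * x"] cong: if_cong)
        then have "Q (c ** munit l i) = (\<Sum>m\<in>UNIV. (c $ m $ l) *\<^sub>C Q (munit m i))"
          by (simp only: Q_sum)
        moreover have "(c ** X) $ k $ l = (c ** Q (munit l i)) $ k $ j"
          by (simp add: X_def matrix_mult_nth)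
        ultimately show ?thesis
          by (simp add: Q_mult[OF c, symmetric] sum_matrix_nth)
            (simp add: X_def matrix_mult_nth mult.commute)
      qed
      then show ?thesis by (simp add: vec_eq_iff)
    qed
    have "X \<in> range mat" by (rule irr) (rule comm)
    then obtain a where "X = mat a" by (rule rangeE)
    then have "Q (munit l i) $ k $ j = (mat a :: complex^'n^'n) $ k $ l" for k l
      by (simp add: X_def flip: \<open>X = mat a\<close>)
    then show ?thesis by (auto simp: mat_nth)
  qed
  then obtain a where a: "\<And>i j k l. Q (munit l i) $ k $ j = (if k = l then a i j else 0)"
    by metis
  have Q_munit: "Q (munit l i) = munit l i ** (\<chi> i j. a i j)" for l i
    by (simp add: vec_eq_iff a munit_mult_nth)
  have Q_eq: "Q x = x ** (\<chi> i j. a i j)" for x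
  proof -
    have "Q x = (\<Sum>p\<in>UNIV. (x $ fst p $ snd p) *\<^sub>C Q (munit (fst p) (snd p)))"
      using Q_sum[of "\<lambda>p. x $ fst p $ snd p" "\<lambda>p. munit (fst p) (snd p)" UNIV]
      by (simp only: matrix_expand[of x, symmetric, unfolded case_prod_unfold])
    also have "\<dots> = (\<Sum>p\<in>UNIV. (x $ fst p $ snd p) *\<^sub>C munit (fst p) (snd p)) ** (\<chi> i j. a i j)"
      by (simp add: Q_munit sum_matrix_mult cscale_mult_left)
    also have "(\<Sum>p\<in>UNIV. (x $ fst p $ snd p) *\<^sub>C munit (fst p) (snd p)) = x"
      using matrix_expand[of x, symmetric] by (simp only: case_prod_unfold)
    finally show ?thesis .
  qed
  have "Q w = w" by (rule uniq) (use w in \<open>simp_all add: hs_inner_eq\<close>)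
  then have "x ** w = Q (x ** w)" by (simp add: Q_eq flip: matrix_mul_assoc)
  then show ?thesis using Q(1) by metis
qed

section \<open>Powers of an operator space\<close>

lemma span_sandwich:
  assumes W: "cmat.subspace W" and gen: "\<And>g. g \<in> G \<Longrightarrow> a ** g ** b \<in> W" and "w \<in> cmat.span G"
  shows "a ** w ** b \<in> W"
  using assms(3)
proof (rule cmat.span_induct)
  show "cmat.subspace {w. a ** w ** b \<in> W}"
    using W unfolding cmat.subspace_def
    by (simp add: matrix_add_ldistrib matrix_add_rdistrib cscale_mult_left cscale_mult_right)
qed (rule gen)

lemma op_prodI: "s \<in> S \<Longrightarrow> t \<in> T \<Longrightarrow> s ** t \<in> op_prod S T"
  unfolding op_prod_def by (intro cmat.span_base) blast

lemma subspace_op_prod: "cmat.subspace (op_prod S T)"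
  unfolding op_prod_def by (rule cmat.subspace_span)

lemma subspace_op_power: "cmat.subspace (op_power S m)"
proof (cases m)
  case 0
  have "mat c + mat d \<in> range mat" "c *\<^sub>C mat d \<in> range mat" for c d :: complex
    by (metis mat_add rangeI) (metis mat_times rangeI)
  then show ?thesis using 0 by (auto simp: cmat.subspace_def intro: mat_0[symmetric])
qed (simp add: subspace_op_prod)

lemma op_power_mono:
  assumes "mat 1 \<in> S" and "m \<le> l"
  shows "op_power S m \<subseteq> op_power S l"
  using assms(2)
proof (induction rule: dec_induct)
  case (step l)
  have "x \<in> op_power S (Suc l)" if "x \<in> op_power S l" for x
    using op_prodI[OF assms(1) that] by simp
  with step show ?case by blast
qed simp

lemma op_power_commutes:
  assumes "\<And>s. s \<in> S \<Longrightarrow> s ** p = p ** s" and "x \<in> op_power (plus_scalars S) m"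
  shows "x ** p = p ** (x :: complex^'n^'n)"
  using assms(2)
proof (induction m arbitrary: x)
  case 0
  then show ?case by (auto simp: mat_mult mult_mat)
next
  case (Suc m)
  have "x \<in> cmat.span {s ** t | s t. s \<in> plus_scalars S \<and> t \<in> op_power (plus_scalars S) m}"
    using Suc.prems by (simp add: op_prod_def)
  then show ?case
  proof (rule cmat.span_induct)
    show "cmat.subspace {x. x ** p = p ** x}"
      unfolding cmat.subspace_def
      by (simp add: matrix_add_ldistrib matrix_add_rdistrib cscale_mult_left cscale_mult_right)
    fix x assume "x \<in> {s ** t | s t. s \<in> plus_scalars S \<and> t \<in> op_power (plus_scalars S) m}"
    then obtain s t where x: "x = s ** t" "s \<in> plus_scalars S" "t \<in> op_power (plus_scalars S) m"
      by blast
    have "s ** p = p ** s"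
      using x(2) assms(1)
      by (auto simp: plus_scalars_def matrix_add_ldistrib matrix_add_rdistrib mat_mult mult_mat)
    moreover have "t ** p = p ** t" using Suc.IH x(3) .
    ultimately show "x ** p = p ** x" unfolding x(1) by (metis matrix_mul_assoc)
  qed
qed

text \<open>
This is a variant of Burnside's theorem in which irreducibility is only assumed for \<open>S\<close> together with a second set
\<open>D\<close> of matrices, while the algebra is generated by \<open>S\<close> and the scalars alone.  It still fills the full matrix algebra because \<open>D\<close>
maps \<open>S\<close> into itself: the non-unital algebra \<open>I\<close> generated by \<open>S\<close> then absorbs \<open>D\<close> from the left and,
by irreducibility, is a left ideal.
\<close>

theorem op_power_eq_UNIV_if_irreducible:
  fixes S D :: "(complex^'n^'n) set"
  assumes S: "cmat.subspace S" and S_adj: "\<And>s. s \<in> S \<Longrightarrow> cadj s \<in> S"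
    and D_adj: "\<And>z. z \<in> D \<Longrightarrow> cadj z \<in> D"
    and DS: "\<And>z s. z \<in> D \<Longrightarrow> s \<in> S \<Longrightarrow> z ** s \<in> S"
    and nonzero: "S \<noteq> {0}"
    and irr: "\<And>p. cadj p = p \<Longrightarrow> p ** p = p \<Longrightarrow> (\<And>s. s \<in> S \<union> D \<Longrightarrow> s ** p = p ** s) \<Longrightarrow>
                p = 0 \<or> p = mat 1"
  shows "\<exists>m. op_power (plus_scalars S) m = UNIV"
proof -
  define T where "T = plus_scalars S"
  have "0 \<in> S" using S by (rule cmat.subspace_0)
  then have "0 + mat 1 \<in> T" unfolding T_def plus_scalars_def by blast
  then have one: "mat 1 \<in> T" by simp
  have ST: "s \<in> T" if "s \<in> S" for s
  proof -
    have "s + mat 0 \<in> T" unfolding T_def plus_scalars_def using that by blast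
    then show ?thesis by simp
  qed
  define U where "U = (\<Union>m. op_power T m)"
  have U: "cmat.subspace U"
    unfolding cmat.subspace_def
  proof (intro conjI ballI allI)
    show "0 \<in> U" unfolding U_def using cmat.subspace_0[OF subspace_op_power] by blast
    fix x c assume "x \<in> U"
    then show "c *\<^sub>C x \<in> U" unfolding U_def using cmat.subspace_scale[OF subspace_op_power] by blast
  next
    fix x y assume "x \<in> U" "y \<in> U"
    then obtain k l where "x \<in> op_power T k" "y \<in> op_power T l" unfolding U_def by blast
    then have "x \<in> op_power T (max k l)" "y \<in> op_power T (max k l)"
      using op_power_mono[OF one] by (meson max.cobounded1 max.cobounded2 subsetD)+
    then have "x + y \<in> op_power T (max k l)" by (rule cmat.subspace_add[OF subspace_op_power])
    then show "x + y \<in> U" unfolding U_def by blast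
  qed
  have one_U: "mat 1 \<in> U" unfolding U_def by (rule UN_I[of 0]) auto
  have SU: "s ** u \<in> U" if s: "s \<in> S" and u: "u \<in> U" for s u
  proof -
    obtain m where "u \<in> op_power T m" using u unfolding U_def by blast
    then have "s ** u \<in> op_power T (Suc m)" using ST[OF s] by (simp add: op_prodI)
    then show ?thesis unfolding U_def by blast
  qed
  define I where "I = op_prod S U"
  have I: "cmat.subspace I" unfolding I_def by (rule subspace_op_prod)
  have I_span: "w \<in> cmat.span {s ** u | s u. s \<in> S \<and> u \<in> U}" if "w \<in> I" for w
    using that by (simp add: I_def op_prod_def)
  have SI: "s \<in> I" if "s \<in> S" for s
    using op_prodI[OF that one_U] by (simp add: I_def)
  have scalar: "x \<in> range mat" if comm: "\<And>c. c \<in> S \<union> D \<Longrightarrow> c ** x = x ** c" for x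
  proof (rule ccontr)
    assume "x \<notin> range mat"
    then obtain p where p: "cadj p = p" "p ** p = p" "p \<noteq> 0" "p \<noteq> mat 1"
      "\<And>c. c ** x = x ** c \<Longrightarrow> cadj c ** x = x ** cadj c \<Longrightarrow> c ** p = p ** c"
      using spectral_projection_exists by metis
    have "c ** p = p ** c" if "c \<in> S \<union> D" for c
    proof (rule p(5))
      show "c ** x = x ** c" using comm that by blast
      show "cadj c ** x = x ** cadj c" using comm that S_adj D_adj by blast
    qed
    then show False using irr[OF p(1,2)] p(3,4) by blast
  qed
  have ideal: "x ** w \<in> I" if "w \<in> I" for x w
  proof (rule left_module_is_left_ideal[OF I _ scalar _ that, where C = "S \<union> D"])
    fix c w assume c: "c \<in> S \<union> D" and w: "w \<in> I"
    have gen: "c ** (s ** u) ** mat 1 \<in> I" if "s \<in> S" "u \<in> U" for s u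
    proof (cases "c \<in> S")
      case True
      then show ?thesis using SU[OF that] by (simp add: I_def op_prodI)
    next
      case False
      with c have "c ** s \<in> S" using DS that(1) by blast
      then show ?thesis using that(2) by (simp add: I_def op_prodI matrix_mul_assoc)
    qed
    have "c ** w ** mat 1 \<in> I"
      by (rule span_sandwich[OF I _ I_span[OF w]]) (use gen in blast)
    then show "c ** w \<in> I" by simp
  qed (use S_adj D_adj in auto)
  \<comment> \<open>\<open>J\<close> is the right ideal of the adjoints of \<open>I\<close>; its generating projection \<open>q\<close> acts on \<open>I\<close> as a right unit.\<close>
  define J where "J = {w. cadj w \<in> I}"
  have "cmat.subspace J"
    using I unfolding cmat.subspace_def J_def by (simp add: cadj_add cadj_cscale)
  moreover have "w ** x \<in> J" if "w \<in> J" for w x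
    using that ideal by (simp add: J_def cadj_mult)
  ultimately obtain q where q: "q \<in> J" "cadj q = q" "q ** q = q" "\<And>w. w \<in> J \<Longrightarrow> q ** w = w"
    using right_ideal_projection[of J] by blast
  have qI: "q \<in> I" using q(1,2) by (simp add: J_def)
  have Iq: "w ** q = w" if "w \<in> I" for w
  proof -
    have "cadj (q ** cadj w) = cadj (cadj w)" using q(4)[of "cadj w"] that by (simp add: J_def)
    then show ?thesis by (simp add: cadj_mult q(2))
  qed
  have qS: "q ** s = s" if "s \<in> S" for s
  proof -
    have "cadj (cadj s ** q) = cadj (cadj s)" using Iq[OF SI[OF S_adj[OF that]]] by simp
    then show ?thesis by (simp add: cadj_mult q(2))
  qed
  \<comment> \<open>Since \<open>q\<close> is a combination of products starting with an element \<open>s\<close> of \<open>S\<close>, and \<open>z s\<close> is again in \<open>S\<close>,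
    the range of \<open>z q\<close> lies in that of \<open>q\<close>.\<close>
  have qzq: "z ** q = q ** z ** q" if z: "z \<in> D" for z
  proof -
    have gen: "(mat 1 - q) ** z ** (s ** u) ** mat 1 \<in> {0}" if "s \<in> S" for s and u :: "complex^'n^'n"
      using qS[OF DS[OF z that]] by (simp add: matrix_mul_assoc matrix_diff_rdistrib)
    have "(mat 1 - q) ** z ** q ** mat 1 \<in> {0}"
      by (rule span_sandwich[OF cmat.subspace_single_0 _ I_span[OF qI]]) (use gen in blast)
    then show ?thesis by (simp add: matrix_diff_rdistrib)
  qed
  have "s ** q = q ** s" if s: "s \<in> S \<union> D" for s
  proof (cases "s \<in> S")
    case True
    then show ?thesis using qS Iq[OF SI] by simp
  next
    case False
    then have s: "s \<in> D" using s by simp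
    have "cadj (cadj s ** q) = cadj (q ** cadj s ** q)" using qzq[OF D_adj[OF s]] by simp
    then have "q ** s = q ** s ** q" unfolding cadj_mult q(2) cadj_cadj matrix_mul_assoc .
    with qzq[OF s] show ?thesis by (rule trans[OF _ sym])
  qed
  then consider "q = 0" | "q = mat 1" using irr[OF q(2,3)] by blast
  then show ?thesis
  proof cases
    case 1
    then have "s = 0" if "s \<in> S" for s using qS[OF that] by simp
    then show ?thesis using nonzero \<open>0 \<in> S\<close> by blast
  next
    case 2
    have "I \<subseteq> U"
    proof
      fix w assume "w \<in> I"
      then have "w \<in> cmat.span {s ** u | s u. s \<in> S \<and> u \<in> U}" by (rule I_span)
      then have "mat 1 ** w ** mat 1 \<in> U"
        by (rule span_sandwich[OF U, rotated]) (auto simp: SU)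
      then show "w \<in> U" by simp
    qed
    moreover have "x \<in> I" for x using ideal[OF qI, of x] 2 by simp
    ultimately have "\<forall>ij. \<exists>m. munit (fst ij) (snd ij) \<in> op_power T m"
      unfolding U_def by blast
    then obtain f where f: "\<And>ij. munit (fst ij) (snd ij) \<in> op_power T (f ij)" by metis
    \<comment> \<open>The powers increase and there are finitely many matrix units, so one power contains them all.\<close>
    define M where "M = Max (range f)"
    have "munit i j \<in> op_power T M" for i j
    proof -
      have "f (i, j) \<le> M" unfolding M_def by (rule Max_ge) auto
      from op_power_mono[OF one this] f[of "(i, j)"] show ?thesis by auto
    qed
    then have "op_power T M = UNIV" by (rule subspace_UNIV_if_munits[OF subspace_op_power])
    then show ?thesis unfolding T_def by blast
  qed
qed

section \<open>Quantum sets and their block projections\<close>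

lemma qset_mult:
  assumes x: "x \<in> qset \<beta>" and y: "y \<in> qset \<beta>"
  shows "x ** y \<in> qset \<beta>"
proof -
  have "x $ i $ k * y $ k $ j = 0" if "\<beta> i \<noteq> \<beta> j" for i j k
    using x y that by (cases "\<beta> i = \<beta> k") (auto simp: qset_def)
  then show ?thesis by (auto simp: qset_def matrix_mult_nth intro!: sum.neutral)
qed

lemma qset_1: "mat 1 \<in> qset \<beta>"
  and qset_diff: "x \<in> qset \<beta> \<Longrightarrow> y \<in> qset \<beta> \<Longrightarrow> x - y \<in> qset \<beta>"
  by (auto simp: qset_def mat_nth)

lemma subspace_qset: "cmat.subspace (qset \<beta>)"
  by (auto simp: cmat.subspace_def qset_def)

lemma block_size_cong: "\<beta> i = \<beta> j \<Longrightarrow> block_size \<beta> i = block_size \<beta> j"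
  by (simp add: block_size_def)

definition block_projection :: "('n::finite \<Rightarrow> 'k) \<Rightarrow> 'n \<Rightarrow> complex^'n^'n"
  where "block_projection \<beta> u = (\<chi> i j. if i = j \<and> \<beta> i = \<beta> u then 1 else 0)"

lemma block_projection_mult_nth:
  "(block_projection \<beta> u ** x) $ i $ j = (if \<beta> i = \<beta> u then x $ i $ j else 0)"
proof -
  have "(block_projection \<beta> u ** x) $ i $ j = (\<Sum>k\<in>UNIV. if k = i then if \<beta> i = \<beta> u then x $ i $ j else 0 else 0)"
    unfolding matrix_mult_nth by (intro sum.cong) (auto simp: block_projection_def)
  then show ?thesis by simp
qed

lemma mult_block_projection_nth:
  "(x ** block_projection \<beta> u) $ i $ j = (if \<beta> j = \<beta> u then x $ i $ j else 0)"
proof -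
  have "(x ** block_projection \<beta> u) $ i $ j = (\<Sum>k\<in>UNIV. if k = j then if \<beta> j = \<beta> u then x $ i $ j else 0 else 0)"
    unfolding matrix_mult_nth by (intro sum.cong) (auto simp: block_projection_def)
  then show ?thesis by simp
qed

lemma cadj_block_projection: "cadj (block_projection \<beta> u) = block_projection \<beta> u"
  by (simp add: vec_eq_iff block_projection_def)

text \<open>
The block projections span the commutant of the quantum set, so this is the double commutant theorem for it.
\<close>

lemma qset_if_commutes_block_projections:
  assumes "\<And>u. block_projection \<beta> u ** x = x ** block_projection \<beta> u"
  shows "x \<in> qset \<beta>"
proof -
  have "x $ i $ j = 0" if "\<beta> i \<noteq> \<beta> j" for i j
  proof -
    have "(block_projection \<beta> i ** x) $ i $ j = (x ** block_projection \<beta> i) $ i $ j"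
      using assms by simp
    then show ?thesis
      using that by (simp add: block_projection_mult_nth mult_block_projection_nth)
  qed
  then show ?thesis by (simp add: qset_def)
qed

lemma dagger_nth:
  "dagger \<beta> \<gamma> f y $ i $ j =
     (if \<beta> i = \<beta> j then qinner \<gamma> (f (munit i j)) y / of_nat (block_size \<beta> i) else 0)"
proof -
  have "dagger \<beta> \<gamma> f y $ i $ j = (\<Sum>p\<in>{(i, j). \<beta> i = \<beta> j}.
      if p = (i, j) then qinner \<gamma> (f (munit i j)) y / of_nat (block_size \<beta> i) else 0)"
    unfolding dagger_def sum_matrix_nth
    by (intro sum.cong refl) (auto simp: munit_nth split: prod.splits if_splits)
  then show ?thesis by simp
qed

lemma qinner_munit_right: "qinner \<beta> z (munit i j) = of_nat (block_size \<beta> j) * cnj (z $ i $ j)"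
proof -
  have "qinner \<beta> z (munit i j) = cnj (qinner \<beta> (munit i j) z)"
    by (simp add: qinner_eq mult.commute)
  then show ?thesis by (simp add: qinner_munit)
qed

section \<open>The edge operator in coordinates\<close>

lemma tensor_map_nth:
  "tensor_map \<beta> \<gamma> f g w $ (a, b) $ (c, d) =
     (\<Sum>(i, j)\<in>{(i, j). \<beta> i = \<beta> j}. \<Sum>(k, l)\<in>{(k, l). \<gamma> k = \<gamma> l}.
        w $ (i, k) $ (j, l) * (f (munit i j) $ a $ c * g (munit k l) $ b $ d))"
  by (simp add: tensor_map_def sum_matrix_nth kron_def case_prod_unfold)

lemma tensor_map_add: "tensor_map \<beta> \<gamma> f g (v + w) = tensor_map \<beta> \<gamma> f g v + tensor_map \<beta> \<gamma> f g w"
  and tensor_map_cscale: "tensor_map \<beta> \<gamma> f g (c *\<^sub>C w) = c *\<^sub>C tensor_map \<beta> \<gamma> f g w"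
  by (simp_all add: vec_eq_iff tensor_map_nth case_prod_unfold distrib_right sum.distrib
      sum_distrib_left mult.assoc)

lemma tensor_map_sum:
  "tensor_map \<beta> \<gamma> f g (\<Sum>a\<in>F. c a *\<^sub>C w a) = (\<Sum>a\<in>F. c a *\<^sub>C tensor_map \<beta> \<gamma> f g (w a))"
proof (induction F rule: infinite_finite_induct)
  case (insert a F)
  then show ?case by (simp add: tensor_map_add tensor_map_cscale)
qed (simp_all add: vec_eq_iff tensor_map_nth case_prod_unfold)

lemma clinear_on_tensor_map: "clinear_on V UNIV (tensor_map \<beta> \<gamma> f g)"
  by (simp add: clinear_on_def tensor_map_add tensor_map_cscale)

lemma clinear_on_comult: "clinear_on V UNIV (comult \<beta>)"
  by (auto simp: clinear_on_def vec_eq_iff comult_nth add_divide_distrib)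

lemma clinear_on_qmult: "clinear_on V UNIV qmult"
  by (simp add: clinear_on_def vec_eq_iff qmult_nth sum.distrib sum_distrib_left)

text \<open>
With the identity as second factor, \<open>f\<close> acts on each slice of \<open>w\<close> with fixed second indices, cut down
to the blocks of \<open>\<beta>\<close> so that it lies in the quantum set.
\<close>

lemma tensor_map_id_right:
  assumes f: "clinear_on (qset \<beta>) W f"
  shows "tensor_map \<beta> \<gamma> f id w $ (a, k) $ (c, l) =
    (if \<gamma> k = \<gamma> l then f (\<chi> i j. if \<beta> i = \<beta> j then w $ (i, k) $ (j, l) else 0) $ a $ c else 0)"
proof -
  let ?v = "\<chi> i j. if \<beta> i = \<beta> j then w $ (i, k) $ (j, l) else 0"
  have inner: "(\<Sum>q\<in>{(k, l). \<gamma> k = \<gamma> l}. w $ (i, fst q) $ (j, snd q) *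
      (f (munit i j) $ a $ c * id (munit (fst q) (snd q)) $ k $ l)) =
    (if \<gamma> k = \<gamma> l then w $ (i, k) $ (j, l) * f (munit i j) $ a $ c else 0)" for i j
  proof -
    have "(\<Sum>q\<in>{(k, l). \<gamma> k = \<gamma> l}. w $ (i, fst q) $ (j, snd q) *
        (f (munit i j) $ a $ c * id (munit (fst q) (snd q)) $ k $ l)) =
      (\<Sum>q\<in>{(k, l). \<gamma> k = \<gamma> l}. if q = (k, l) then w $ (i, k) $ (j, l) * f (munit i j) $ a $ c else 0)"
      by (intro sum.cong refl) (auto simp: munit_nth)
    then show ?thesis by simp
  qed
  have "f ?v = (\<Sum>(i, j)\<in>{(i, j). \<beta> i = \<beta> j}. (?v $ i $ j) *\<^sub>C f (munit i j))"
    by (rule clinear_on_expand[OF f]) (simp add: qset_def)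
  then have "f ?v $ a $ c = (\<Sum>p\<in>{(i, j). \<beta> i = \<beta> j}. w $ (fst p, k) $ (snd p, l) * f (munit (fst p) (snd p)) $ a $ c)"
    by (simp add: sum_matrix_nth case_prod_unfold)
  then show ?thesis
    unfolding tensor_map_nth case_prod_unfold inner[unfolded case_prod_unfold] by simp
qed

lemma tensor_map_id_left:
  assumes g: "clinear_on (qset \<gamma>) W g"
  shows "tensor_map \<beta> \<gamma> id g w $ (a, k) $ (c, l) =
    (if \<beta> a = \<beta> c then g (\<chi> i j. if \<gamma> i = \<gamma> j then w $ (a, i) $ (c, j) else 0) $ k $ l else 0)"
proof -
  let ?v = "\<chi> i j. if \<gamma> i = \<gamma> j then w $ (a, i) $ (c, j) else 0"
  have "g ?v = (\<Sum>(i, j)\<in>{(i, j). \<gamma> i = \<gamma> j}. (?v $ i $ j) *\<^sub>C g (munit i j))"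
    by (rule clinear_on_expand[OF g]) (simp add: qset_def)
  then have v: "g ?v $ k $ l = (\<Sum>q\<in>{(i, j). \<gamma> i = \<gamma> j}. w $ (a, fst q) $ (c, snd q) * g (munit (fst q) (snd q)) $ k $ l)"
    by (simp add: sum_matrix_nth case_prod_unfold)
  have "tensor_map \<beta> \<gamma> id g w $ (a, k) $ (c, l) =
    (\<Sum>p\<in>{(i, j). \<beta> i = \<beta> j}. if p = (a, c) then g ?v $ k $ l else 0)"
    unfolding tensor_map_nth v case_prod_unfold
    by (intro sum.cong refl) (auto simp: munit_nth)
  then show ?thesis by simp
qed

text \<open>
In \<open>m\<^sup>\<dagger> \<otimes> id\<close> the comultiplication doubles an index and divides by the block size; \<open>A\<close> acts on the slice thus created,
and the final multiplication contracts the index \<open>m\<close>.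
\<close>

lemma edge_op_nth:
  assumes A: "clinear_on (qset \<beta>) (qset \<beta>) A"
  shows "edge_op \<beta> A w $ (a, k) $ (c, l) =
    (if \<beta> a = \<beta> c then \<Sum>m\<in>{m. \<beta> m = \<beta> l}.
       A (\<chi> b d. if b = c \<and> \<beta> d = \<beta> a then w $ (a, m) $ (d, l) / of_nat (block_size \<beta> a) else 0) $ k $ m
     else 0)"
proof (cases "\<beta> a = \<beta> c")
  case True
  define u where "u = tensor_assoc (tensor_map \<beta> \<beta> (comult \<beta>) id w)"
  have u: "u $ (a, (b, m)) $ (c, (d, l)) =
      (if b = c \<and> \<beta> m = \<beta> l \<and> \<beta> b = \<beta> d then w $ (a, m) $ (d, l) / of_nat (block_size \<beta> a) else 0)"
    for b m d l
    using True
    by (auto simp: u_def tensor_assoc_def tensor_map_id_right[OF clinear_on_comult] comult_nth)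
  \<comment> \<open>The contraction leaves only the indices \<open>m\<close> in the common block of \<open>k\<close> and \<open>l\<close>; the condition on \<open>k\<close> can be dropped
    because the values of \<open>A\<close> are block diagonal.\<close>
  have A0: "A x $ i $ j = 0" if "\<beta> i \<noteq> \<beta> j" "x \<in> qset \<beta>" for x i j
    using A that unfolding clinear_on_def qset_def by blast
  have "edge_op \<beta> A w $ (a, k) $ (c, l) =
      (\<Sum>m\<in>UNIV. if \<beta> k = \<beta> m \<and> \<beta> m = \<beta> l then
        A (\<chi> b d. if \<beta> b = \<beta> d then u $ (a, (b, m)) $ (c, (d, l)) else 0) $ k $ m else 0)"
    using True
    by (simp add: edge_op_def u_def[symmetric] tensor_map_id_left[OF clinear_on_qmult]
      tensor_map_id_left[OF clinear_on_tensor_map] qmult_nth tensor_map_id_right[OF A] cong: if_cong)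
  also have "\<dots> = (\<Sum>m\<in>UNIV. if \<beta> m = \<beta> l then
       A (\<chi> b d. if b = c \<and> \<beta> d = \<beta> a then w $ (a, m) $ (d, l) / of_nat (block_size \<beta> a) else 0) $ k $ m
     else 0)"
  proof (intro sum.cong refl)
    fix m
    let ?x = "\<chi> b d. if b = c \<and> \<beta> d = \<beta> a then w $ (a, m) $ (d, l) / of_nat (block_size \<beta> a) else 0"
    have "?x \<in> qset \<beta>" using True by (auto simp: qset_def)
    moreover have "(\<chi> b d. if \<beta> b = \<beta> d then u $ (a, (b, m)) $ (c, (d, l)) else 0) = ?x" if "\<beta> m = \<beta> l"
      using that True by (auto simp: vec_eq_iff u)
    ultimately show "(if \<beta> k = \<beta> m \<and> \<beta> m = \<beta> l then
        A (\<chi> b d. if \<beta> b = \<beta> d then u $ (a, (b, m)) $ (c, (d, l)) else 0) $ k $ m else 0) =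
      (if \<beta> m = \<beta> l then A ?x $ k $ m else 0)"
      using A0[of k m ?x] by auto
  qed
  finally show ?thesis using True by (simp add: sum.If_cases)
next
  case False
  then show ?thesis by (simp add: edge_op_def tensor_map_id_left[OF clinear_on_qmult])
qed

lemma edge_op_sum:
  "edge_op \<beta> A (\<Sum>a\<in>F. c a *\<^sub>C w a) = (\<Sum>a\<in>F. c a *\<^sub>C edge_op \<beta> A (w a))"
proof -
  have "tensor_assoc (\<Sum>a\<in>F. c a *\<^sub>C v a) = (\<Sum>a\<in>F. c a *\<^sub>C tensor_assoc (v a))"
    for v :: "_ \<Rightarrow> complex^(('a \<times> 'a) \<times> 'a)^(('a \<times> 'a) \<times> 'a)"
    by (simp add: vec_eq_iff tensor_assoc_def sum_matrix_nth)
  then show ?thesis by (simp add: edge_op_def tensor_map_sum)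
qed

lemma clinear_on_0: "clinear_on (qset \<beta>) W f \<Longrightarrow> f 0 = 0"
  using clinear_on_expand[of \<beta> W f 0] by (simp add: qset_def case_prod_unfold)

lemma clinear_on_cscale: "clinear_on V W f \<Longrightarrow> x \<in> V \<Longrightarrow> f (c *\<^sub>C x) = c *\<^sub>C f x"
  and clinear_on_add: "clinear_on V W f \<Longrightarrow> x \<in> V \<Longrightarrow> y \<in> V \<Longrightarrow> f (x + y) = f x + f y"
  and clinear_on_closed: "clinear_on V W f \<Longrightarrow> x \<in> V \<Longrightarrow> f x \<in> W"
  by (simp_all add: clinear_on_def)

lemma edge_op_kron_munit:
  assumes A: "clinear_on (qset \<beta>) (qset \<beta>) A" and ij: "\<beta> i = \<beta> j" and kl: "\<beta> k = \<beta> l"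
  shows "edge_op \<beta> A (kron (munit i j) (munit k l)) $ (a, b) $ (c, d) =
    (if a = i \<and> \<beta> c = \<beta> i \<and> d = l then A (munit c j) $ b $ k / of_nat (block_size \<beta> i) else 0)"
proof -
  have *: "A (\<chi> b' d'. if b' = c \<and> \<beta> d' = \<beta> a then kron (munit i j) (munit k l) $ (a, m) $ (d', d) / of_nat (block_size \<beta> a) else 0) $ b $ m
    = (if m = k then if a = i \<and> d = l then A (munit c j) $ b $ k / of_nat (block_size \<beta> i) else 0 else 0)"
    (is "A ?x $ b $ m = _")
    if "\<beta> a = \<beta> c" for m
  proof (cases "a = i \<and> d = l \<and> m = k")
    case True
    then have "?x = (1 / of_nat (block_size \<beta> i)) *\<^sub>C munit c j"
      using that ij by (auto simp: vec_eq_iff kron_def munit_nth)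
    moreover have "munit c j \<in> qset \<beta>" using True that ij by (simp add: munit_qset)
    ultimately show ?thesis using True by (simp add: clinear_on_cscale[OF A])
  next
    case False
    then have "?x = 0" by (auto simp: vec_eq_iff kron_def munit_nth)
    then show ?thesis using False by (auto simp: clinear_on_0[OF A])
  qed
  show ?thesis
  proof (cases "\<beta> a = \<beta> c")
    case True
    have "edge_op \<beta> A (kron (munit i j) (munit k l)) $ (a, b) $ (c, d) =
      (\<Sum>m\<in>{m. \<beta> m = \<beta> d}. if m = k then if a = i \<and> d = l
         then A (munit c j) $ b $ k / of_nat (block_size \<beta> i) else 0 else 0)"
      unfolding edge_op_nth[OF A] if_P[OF True] *[OF True] ..
    then show ?thesis using True kl by auto
  next
    case False
    then show ?thesis unfolding edge_op_nth[OF A] by auto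
  qed
qed

lemma edge_proj_nth:
  assumes A: "clinear_on (qset \<beta>) (qset \<beta>) A"
  shows "edge_proj \<beta> A $ (i, k) $ (j, l) =
    (if \<beta> i = \<beta> j then A (munit j i) $ k $ l / of_nat (block_size \<beta> i) else 0)"
proof -
  have *: "A (\<chi> b d. if b = j \<and> \<beta> d = \<beta> i then kron (mat 1) (mat 1) $ (i, m) $ (d, l) / of_nat (block_size \<beta> i) else 0) $ k $ m
    = (if m = l then A (munit j i) $ k $ l / of_nat (block_size \<beta> i) else 0)" (is "A ?x $ k $ m = _")
    if "\<beta> i = \<beta> j" for m
  proof (cases "m = l")
    case True
    then have "?x = (1 / of_nat (block_size \<beta> i)) *\<^sub>C munit j i"
      by (auto simp: vec_eq_iff kron_def munit_nth mat_nth)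
    moreover have "munit j i \<in> qset \<beta>" using that by (simp add: munit_qset)
    ultimately show ?thesis using True by (simp add: clinear_on_cscale[OF A])
  next
    case False
    then have "?x = 0" by (auto simp: vec_eq_iff kron_def mat_nth)
    then show ?thesis using False by (auto simp: clinear_on_0[OF A])
  qed
  show ?thesis
  proof (cases "\<beta> i = \<beta> j")
    case True
    have "edge_proj \<beta> A $ (i, k) $ (j, l) = (\<Sum>m\<in>{m. \<beta> m = \<beta> l}.
        if m = l then A (munit j i) $ k $ l / of_nat (block_size \<beta> i) else 0)"
      unfolding edge_proj_def edge_op_nth[OF A] if_P[OF True] *[OF True] ..
    then show ?thesis using True by auto
  next
    case False
    then show ?thesis unfolding edge_proj_def edge_op_nth[OF A] by auto
  qed
qed

section \<open>The operator space of a quantum graph\<close>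

lemma hs_inner_mult_right: "hs_inner x (y ** c) = hs_inner (x ** cadj c) y"
  unfolding hs_inner_def cadj_mult cadj_cadj matrix_mul_assoc[symmetric]
  by (subst trace_mul_sym) (simp add: matrix_mul_assoc)

lemma act_add: "act t (x + y) = act t x + act t y"
  and act_cscale: "act t (c *\<^sub>C x) = c *\<^sub>C act t x"
  by (simp_all add: vec_eq_iff act_nth distrib_left sum.distrib sum_distrib_left mult.left_commute)

lemma clinear_on_mult_munit_nth:
  assumes A: "clinear_on (qset \<beta>) (qset \<beta>) A" and p: "p \<in> qset \<beta>" and ij: "\<beta> i = \<beta> j"
  shows "A (p ** munit j i) $ k $ l = (\<Sum>a\<in>{a. \<beta> a = \<beta> i}. p $ a $ j * A (munit a i) $ k $ l)"
proof -
  have "p ** munit j i \<in> qset \<beta>" using p ij by (intro qset_mult) (auto simp: munit_qset)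
  moreover have "p ** munit j i = (\<Sum>a\<in>{a. \<beta> a = \<beta> i}. p $ a $ j *\<^sub>C munit a i)"
    using p ij by (auto simp: vec_eq_iff sum_matrix_nth mult_munit_nth munit_nth qset_def
        if_distrib[of "\<lambda>z. _ * z"] cong: if_cong)
  ultimately show ?thesis
    using clinear_on_sum[OF A, of "{a. \<beta> a = \<beta> i}" "\<lambda>a. munit a i" "\<lambda>a. p $ a $ j"]
    by (simp add: munit_qset sum_matrix_nth)
qed

text \<open>
The projection \<open>p\<close> on the right moves into the argument of \<open>A\<close>, because
\<open>\<Sum>\<^sub>a A(e\<^sub>a\<^sub>i) p\<^sub>a\<^sub>j = A(p e\<^sub>j\<^sub>i)\<close>.
\<close>

lemma sandwich_edge_munit_nth:
  assumes A: "clinear_on (qset \<beta>) (qset \<beta>) A" and p: "p \<in> qset \<beta>"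
  shows "(r ** act (edge_proj \<beta> A) (munit l i) ** p) $ k $ j =
    (if \<beta> i = \<beta> j then (r ** A (p ** munit j i)) $ k $ l / of_nat (block_size \<beta> i) else 0)"
proof -
  have act: "act (edge_proj \<beta> A) (munit l i) $ b $ a =
      (if \<beta> a = \<beta> i then A (munit a i) $ b $ l / of_nat (block_size \<beta> i) else 0)" for a b
  proof -
    have "act (edge_proj \<beta> A) (munit l i) $ b $ a =
      (\<Sum>l'\<in>UNIV. \<Sum>i'\<in>UNIV. if l' = l then if i' = i then edge_proj \<beta> A $ (i, b) $ (a, l) else 0 else 0)"
      unfolding act_nth by (intro sum.cong refl) (auto simp: munit_nth)
    also have "\<dots> = edge_proj \<beta> A $ (i, b) $ (a, l)"
      by (subst sum.swap) simp
    finally show ?thesis by (auto simp: edge_proj_nth[OF A])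
  qed
  have "(r ** act (edge_proj \<beta> A) (munit l i) ** p) $ k $ j =
      (\<Sum>b\<in>UNIV. r $ k $ b * (\<Sum>a\<in>UNIV. act (edge_proj \<beta> A) (munit l i) $ b $ a * p $ a $ j))"
    by (simp add: matrix_mult_nth flip: matrix_mul_assoc)
  also have "\<dots> = (\<Sum>b\<in>UNIV. r $ k $ b *
      ((\<Sum>a\<in>{a. \<beta> a = \<beta> i}. p $ a $ j * A (munit a i) $ b $ l) / of_nat (block_size \<beta> i)))"
    unfolding act
    by (intro sum.cong refl arg_cong2[where f = "(*)"])
      (auto simp: sum_divide_distrib mult.commute intro!: sum.mono_neutral_cong_right split: if_splits)
  also have "\<dots> = (if \<beta> i = \<beta> j then (r ** A (p ** munit j i)) $ k $ l / of_nat (block_size \<beta> i) else 0)"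
  proof (cases "\<beta> i = \<beta> j")
    case True
    then show ?thesis
      by (simp add: matrix_mult_nth[of r] clinear_on_mult_munit_nth[OF A p] flip: sum_divide_distrib)
  next
    case False
    then have "p $ a $ j = 0" if "\<beta> a = \<beta> i" for a using p that by (auto simp: qset_def)
    then show ?thesis using False by simp
  qed
  finally show ?thesis .
qed

lemma sandwich_op_space_iff:
  assumes A: "clinear_on (qset \<beta>) (qset \<beta>) A" and p: "p \<in> qset \<beta>"
  shows "(\<forall>s\<in>op_space \<beta> A. r ** s ** p = 0) \<longleftrightarrow> (\<forall>x\<in>qset \<beta>. r ** A (p ** x) = 0)"
proof -
  have "(\<forall>s\<in>op_space \<beta> A. r ** s ** p = 0) \<longleftrightarrow>
      (\<forall>l i. r ** act (edge_proj \<beta> A) (munit l i) ** p = 0)" (is "?L \<longleftrightarrow> ?M")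
  proof
    assume M: ?M
    have "cmat.subspace {x. r ** act (edge_proj \<beta> A) x ** p = 0}"
      unfolding cmat.subspace_def using act_cscale[of "edge_proj \<beta> A" 0 0]
      by (simp add: act_add act_cscale matrix_add_ldistrib matrix_add_rdistrib
          cscale_mult_left cscale_mult_right)
    from subspace_UNIV_if_munits[OF this] M show ?L by (auto simp: op_space_def)
  qed (auto simp: op_space_def)
  also have "\<dots> \<longleftrightarrow> (\<forall>i j. \<beta> i = \<beta> j \<longrightarrow> r ** A (p ** munit j i) = 0)"
    by (auto simp: vec_eq_iff sandwich_edge_munit_nth[OF A p] block_size_nonzero)
  also have "\<dots> \<longleftrightarrow> (\<forall>x\<in>qset \<beta>. r ** A (p ** x) = 0)" (is "?M \<longleftrightarrow> ?R")
  proof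
    assume M: ?M
    define W where "W = {x\<in>qset \<beta>. r ** A (p ** x) = 0}"
    have W: "cmat.subspace W"
      using p subspace_qset[of \<beta>] clinear_on_0[OF A] unfolding cmat.subspace_def W_def
      by (simp add: matrix_add_ldistrib cscale_mult_right qset_mult
          clinear_on_add[OF A] clinear_on_cscale[OF A])
    have "munit a b \<in> W" if "\<beta> a = \<beta> b" for a b
      using M that by (simp add: W_def munit_qset)
    then have sum: "(\<Sum>(i, j)\<in>{(i, j). \<beta> i = \<beta> j}. (x $ i $ j) *\<^sub>C munit i j) \<in> W" for x
      by (intro cmat.subspace_sum[OF W]) (auto intro!: cmat.subspace_scale[OF W])
    have "x \<in> W" if "x \<in> qset \<beta>" for x
      by (subst qset_expand[OF that]) (rule sum)
    then show ?R by (simp add: W_def)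
  qed (simp add: munit_qset)
  finally show ?thesis .
qed

lemma subspace_op_space: "cmat.subspace (op_space \<beta> A)"
  unfolding cmat.subspace_def op_space_def
proof (intro conjI ballI allI)
  have "act (edge_proj \<beta> A) 0 = 0" using act_cscale[of _ 0 0] by simp
  then show "0 \<in> range (act (edge_proj \<beta> A))" by (metis rangeI)
qed (auto simp: act_add[symmetric] act_cscale[symmetric])

lemma block_projection_mult_op_space:
  assumes A: "clinear_on (qset \<beta>) (qset \<beta>) A" and s: "s \<in> op_space \<beta> A"
  shows "block_projection \<beta> u ** s \<in> op_space \<beta> A"
proof -
  obtain x where x: "s = act (edge_proj \<beta> A) x" using s by (auto simp: op_space_def)
  have "block_projection \<beta> u ** s = act (edge_proj \<beta> A) (block_projection \<beta> u ** x)"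
  proof -
    have "edge_proj \<beta> A $ (i, k) $ (j, l) = 0" if "\<beta> k \<noteq> \<beta> l" for i j k l
      using clinear_on_closed[OF A, of "munit j i"] that
      by (auto simp: edge_proj_nth[OF A] munit_qset) (simp add: qset_def)
    then have "(if \<beta> k = \<beta> u then edge_proj \<beta> A $ (i, k) $ (j, l) * x $ l $ i else 0) =
        edge_proj \<beta> A $ (i, k) $ (j, l) * (if \<beta> l = \<beta> u then x $ l $ i else 0)" for i j k l
      by auto
    moreover have "(block_projection \<beta> u ** s) $ k $ j = (\<Sum>l\<in>UNIV. \<Sum>i\<in>UNIV.
        if \<beta> k = \<beta> u then edge_proj \<beta> A $ (i, k) $ (j, l) * x $ l $ i else 0)" for k j
      by (simp add: block_projection_mult_nth x act_nth)
    ultimately have "(block_projection \<beta> u ** s) $ k $ j =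
        act (edge_proj \<beta> A) (block_projection \<beta> u ** x) $ k $ j" for k j
      by (simp only: act_nth block_projection_mult_nth)
    then show ?thesis by (simp add: vec_eq_iff)
  qed
  then show ?thesis by (simp add: op_space_def)
qed

text \<open>
Self-adjointness of \<open>A\<close> compares entries up to complex conjugation, and \<open>A(x\<^sup>*) = A(x)\<^sup>*\<close> removes the conjugation.  The block sizes
are the weights of the inner product.
\<close>

lemma undirected_munit_nth:
  assumes A: "quantum_graph \<beta> A" and u: "undirected \<beta> A" and ij: "\<beta> i = \<beta> j" and kl: "\<beta> k = \<beta> l"
  shows "of_nat (block_size \<beta> i) * A (munit k l) $ i $ j = of_nat (block_size \<beta> l) * A (munit j i) $ l $ k"
proof -
  have real: "A (munit j i) = cadj (A (munit i j))"
    using A ij by (auto simp: quantum_graph_def munit_qset dest!: bspec[of _ _ "munit i j"])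
  have "A (munit k l) $ i $ j = dagger \<beta> \<beta> A (munit k l) $ i $ j"
    using u kl by (simp add: undirected_def munit_qset)
  also have "\<dots> = of_nat (block_size \<beta> l) * A (munit j i) $ l $ k / of_nat (block_size \<beta> i)"
    using ij by (simp add: dagger_nth qinner_munit_right real)
  finally show ?thesis using block_size_nonzero[of \<beta> i] by simp
qed

text \<open>
By \<open>undirected_munit_nth\<close> the projection of the edge relation satisfies
\<open>\<pi>(x)\<^sup>* = \<pi>(x\<^sup>*)\<close> for its action \<open>\<pi>\<close> on matrices.
\<close>

lemma cadj_op_space:
  assumes A: "quantum_graph \<beta> A" and u: "undirected \<beta> A" and s: "s \<in> op_space \<beta> A"
  shows "cadj s \<in> op_space \<beta> A"
proof -
  have lin: "clinear_on (qset \<beta>) (qset \<beta>) A" using A by (simp add: quantum_graph_def)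
  obtain x where x: "s = act (edge_proj \<beta> A) x" using s by (auto simp: op_space_def)
  have t: "cnj (edge_proj \<beta> A $ (i, k) $ (j, l)) = edge_proj \<beta> A $ (l, j) $ (k, i)" for i j k l
  proof (cases "\<beta> i = \<beta> j \<and> \<beta> k = \<beta> l")
    case True
    then have "A (munit i j) = cadj (A (munit j i))"
      using A by (auto simp: quantum_graph_def munit_qset dest!: bspec[of _ _ "munit j i"])
    moreover have "of_nat (block_size \<beta> l) * A (munit i j) $ l $ k =
        of_nat (block_size \<beta> j) * A (munit k l) $ j $ i"
      using True by (intro undirected_munit_nth[OF A u]) auto
    ultimately show ?thesis
      using True block_size_nonzero[of \<beta> l] block_size_nonzero[of \<beta> j] block_size_cong[of \<beta> i j]
      by (auto simp: edge_proj_nth[OF lin] frac_eq_eq mult.commute)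
  next
    case False
    have "A y $ a $ b = 0" if "\<beta> a \<noteq> \<beta> b" "y \<in> qset \<beta>" for y a b
      using clinear_on_closed[OF lin that(2)] that(1) by (simp add: qset_def)
    then show ?thesis using False by (auto simp: edge_proj_nth[OF lin] munit_qset)
  qed
  have "cadj s $ k $ j = act (edge_proj \<beta> A) (cadj x) $ k $ j" for k j
  proof -
    have "cadj s $ k $ j = (\<Sum>l\<in>UNIV. \<Sum>i\<in>UNIV. edge_proj \<beta> A $ (l, k) $ (j, i) * cnj (x $ l $ i))"
      by (simp add: x act_nth t)
    also have "\<dots> = (\<Sum>i\<in>UNIV. \<Sum>l\<in>UNIV. edge_proj \<beta> A $ (l, k) $ (j, i) * cnj (x $ l $ i))"
      by (rule sum.swap)
    also have "\<dots> = act (edge_proj \<beta> A) (cadj x) $ k $ j"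
      by (simp add: act_nth)
    finally show ?thesis .
  qed
  then have "cadj s = act (edge_proj \<beta> A) (cadj x)"
    unfolding vec_eq_iff by blast
  then show ?thesis by (simp add: op_space_def)
qed

section \<open>Separating projections\<close>

text \<open>
In graph terms, the vertices split into the parts \<open>p\<close> and \<open>1 - p\<close> with no edge between them.
\<close>

definition separates :: "('n::finite \<Rightarrow> 'k) \<Rightarrow> (complex^'n^'n \<Rightarrow> complex^'n^'n) \<Rightarrow> complex^'n^'n \<Rightarrow> bool"
  where "separates \<beta> A p \<longleftrightarrow> is_projection \<beta> p \<and> p \<noteq> 0 \<and> p \<noteq> mat 1 \<and>
    (\<forall>s\<in>op_space \<beta> A. s ** p = p ** s)"

text \<open>
The two corners of \<open>s\<close> and of \<open>s\<^sup>*\<close> are exchanged by taking adjoints, so over an adjoint-closed set one corner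
vanishes identically if and only if the other does.
\<close>

lemma commutes_iff_corner_eq_0:
  assumes S: "\<And>s. s \<in> S \<Longrightarrow> cadj s \<in> S" and p: "cadj p = p" "p ** p = p"
  shows "(\<forall>s\<in>S. s ** p = p ** s) \<longleftrightarrow> (\<forall>s\<in>S. (mat 1 - p) ** s ** p = 0)"
    and "(\<forall>s\<in>S. s ** p = p ** s) \<longleftrightarrow> (\<forall>s\<in>S. p ** s ** (mat 1 - p) = 0)"
proof -
  have *: "(mat 1 - p) ** s ** p = 0 \<longleftrightarrow> s ** p = p ** s ** p"
    "p ** s ** (mat 1 - p) = 0 \<longleftrightarrow> p ** s = p ** s ** p" for s
    by (simp_all add: matrix_diff_ldistrib matrix_diff_rdistrib)
  have comm: "(mat 1 - p) ** s ** p = 0 \<and> p ** s ** (mat 1 - p) = 0" if "s ** p = p ** s" for s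
  proof -
    have "p ** s ** p = p ** s" using p(2) that by (metis matrix_mul_assoc)
    then show ?thesis unfolding * using that by simp
  qed
  have adj: "(mat 1 - p) ** cadj s ** p = 0 \<longleftrightarrow> p ** s ** (mat 1 - p) = 0" for s
  proof -
    have "cadj ((mat 1 - p) ** cadj s ** p) = p ** s ** (mat 1 - p)"
      by (simp add: cadj_mult cadj_diff p(1) matrix_mul_assoc)
    then show ?thesis by (metis cadj_0 cadj_cadj)
  qed
  have both: "s ** p = p ** s" if "(mat 1 - p) ** s ** p = 0" "p ** s ** (mat 1 - p) = 0" for s
    using that unfolding * by (rule trans[OF _ sym])
  show "(\<forall>s\<in>S. s ** p = p ** s) \<longleftrightarrow> (\<forall>s\<in>S. (mat 1 - p) ** s ** p = 0)"
    using comm adj both S by blast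
  show "(\<forall>s\<in>S. s ** p = p ** s) \<longleftrightarrow> (\<forall>s\<in>S. p ** s ** (mat 1 - p) = 0)"
    using comm adj both S by (metis cadj_cadj)
qed

lemma separates_iff_edges:
  assumes A: "quantum_graph \<beta> A" "undirected \<beta> A" and p: "is_projection \<beta> p"
  shows "(\<forall>s\<in>op_space \<beta> A. s ** p = p ** s) \<longleftrightarrow> (\<forall>x\<in>qset \<beta>. (mat 1 - p) ** A (p ** x) = 0)"
    and "(\<forall>s\<in>op_space \<beta> A. s ** p = p ** s) \<longleftrightarrow> (\<forall>x\<in>qset \<beta>. p ** A ((mat 1 - p) ** x) = 0)"
proof -
  have lin: "clinear_on (qset \<beta>) (qset \<beta>) A" using A by (simp add: quantum_graph_def)
  have pV: "p \<in> qset \<beta>" "mat 1 - p \<in> qset \<beta>" and pp: "cadj p = p" "p ** p = p"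
    using p by (auto simp: is_projection_def qset_1 qset_diff)
  note c = commutes_iff_corner_eq_0[OF cadj_op_space[OF A] pp]
  show "(\<forall>s\<in>op_space \<beta> A. s ** p = p ** s) \<longleftrightarrow> (\<forall>x\<in>qset \<beta>. (mat 1 - p) ** A (p ** x) = 0)"
    by (rule trans[OF c(1) sandwich_op_space_iff[OF lin pV(1)]])
  show "(\<forall>s\<in>op_space \<beta> A. s ** p = p ** s) \<longleftrightarrow> (\<forall>x\<in>qset \<beta>. p ** A ((mat 1 - p) ** x) = 0)"
    by (rule trans[OF c(2) sandwich_op_space_iff[OF lin pV(2)]])
qed

theorem not_cgw_connected_iff:
  assumes "quantum_graph \<beta> A" "undirected \<beta> A"
  shows "\<not> cgw_connected \<beta> A \<longleftrightarrow> (\<exists>p. separates \<beta> A p)"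
  unfolding cgw_connected_def separates_def using separates_iff_edges(2)[OF assms] by blast

theorem not_cds_connected_iff:
  assumes A: "quantum_graph \<beta> A" "undirected \<beta> A"
  shows "\<not> cds_connected \<beta> A \<longleftrightarrow> (\<exists>p. separates \<beta> A p)"
proof
  assume "\<exists>p. separates \<beta> A p"
  then obtain p where p: "p ** p = p" "p \<noteq> 0" "p \<noteq> mat 1"
    and comm: "\<And>s. s \<in> op_space \<beta> A \<Longrightarrow> s ** p = p ** s"
    unfolding separates_def is_projection_def by blast
  show "\<not> cds_connected \<beta> A"
  proof
    assume "cds_connected \<beta> A"
    then obtain m where m: "op_power (plus_scalars (op_space \<beta> A)) m = UNIV"
      by (auto simp: cds_connected_def)
    have "p ** x ** (mat 1 - p) = 0" for x
    proof -
      have "x ** p = p ** x" using op_power_commutes[where x = x and m = m, OF comm] m by blast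
      then have "p ** x ** (mat 1 - p) = x ** (p ** (mat 1 - p))" by (simp add: matrix_mul_assoc)
      then show ?thesis by (simp add: matrix_diff_ldistrib p(1))
    qed
    then have "p = 0" using p(3) by (intro matrix_eq_0_if_sandwiched[of p "mat 1 - p"]) auto
    with p(2) show False by contradiction
  qed
next
  assume nc: "\<not> cds_connected \<beta> A"
  have lin: "clinear_on (qset \<beta>) (qset \<beta>) A" using A by (simp add: quantum_graph_def)
  show "\<exists>p. separates \<beta> A p"
  proof (cases "op_space \<beta> A = {0}")
    case True
    \<comment> \<open>Every rank-one coordinate projection commutes with the zero space; it is trivial only in dimension one,
      where already the scalars are everything.\<close>
    define p :: "complex^'a^'a" where "p = munit undefined undefined"
    have "is_projection \<beta> p" by (simp add: is_projection_def p_def munit_qset munit_mult)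
    moreover have "p $ undefined $ undefined \<noteq> 0" by (simp add: p_def munit_nth)
    then have "p \<noteq> 0" by auto
    moreover have "p \<noteq> mat 1"
    proof
      assume "p = mat 1"
      have *: "i = undefined" for i :: 'a
      proof (rule ccontr)
        assume "i \<noteq> undefined"
        then have "p $ i $ i = 0" by (simp add: p_def munit_nth)
        with \<open>p = mat 1\<close> show False by (simp add: mat_nth)
      qed
      have "x = mat (x $ undefined $ undefined)" for x :: "complex^'a^'a"
      proof -
        have "x $ i $ j = mat (x $ undefined $ undefined) $ i $ j" for i j
          using *[of i] *[of j] by (simp add: mat_nth)
        then show ?thesis unfolding vec_eq_iff by blast
      qed
      then have "op_power (plus_scalars (op_space \<beta> A)) 0 = UNIV" by auto
      with nc show False unfolding cds_connected_def by blast
    qed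
    ultimately show ?thesis using True by (auto simp: separates_def)
  next
    case False
    show ?thesis
    proof (rule ccontr)
      assume none: "\<nexists>p. separates \<beta> A p"
      have "\<exists>m. op_power (plus_scalars (op_space \<beta> A)) m = UNIV"
      proof (rule op_power_eq_UNIV_if_irreducible[where D = "range (block_projection \<beta>)"])
        fix p :: "complex^'a^'a"
        assume p: "cadj p = p" "p ** p = p"
          and comm: "\<And>s. s \<in> op_space \<beta> A \<union> range (block_projection \<beta>) \<Longrightarrow> s ** p = p ** s"
        have "p \<in> qset \<beta>" by (rule qset_if_commutes_block_projections) (simp add: comm)
        then have "is_projection \<beta> p" using p by (simp add: is_projection_def)
        then show "p = 0 \<or> p = mat 1" using none comm unfolding separates_def by blast
      qed (use False cadj_op_space[OF A] block_projection_mult_op_space[OF lin] in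
          \<open>auto simp: subspace_op_space cadj_block_projection\<close>)
      with nc show False by (simp add: cds_connected_def)
    qed
  qed
qed

section \<open>Projective subsets\<close>

lemma qinner_mult_munit:
  "qinner \<beta> (p ** munit i j) a = of_nat (block_size \<beta> j) * (cadj p ** a) $ i $ j"
  by (simp add: qinner_def cadj_mult munit_mult_nth mult_delta_right flip: matrix_mul_assoc)

text \<open>
Right linearity gives \<open>P(x) = P(1) x\<close>; idempotence and self-adjointness of \<open>P\<close>, evaluated at the identity, are those of \<open>P(1)\<close>.
\<close>

lemma proj_subset_imp_projection:
  assumes P: "proj_subset \<beta> P"
  shows "is_projection \<beta> (P (mat 1))"
    and "x \<in> qset \<beta> \<Longrightarrow> P x = P (mat 1) ** x"
proof -
  have mult: "P (a ** b) = P a ** b" if "a \<in> qset \<beta>" "b \<in> qset \<beta>" for a b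
    using P that by (simp add: proj_subset_def)
  show P_eq: "P x = P (mat 1) ** x" if "x \<in> qset \<beta>" for x
    using mult[OF qset_1 that] by simp
  have V: "P (mat 1) \<in> qset \<beta>" using P qset_1 by (auto simp: proj_subset_def clinear_on_def)
  have idem: "P (mat 1) ** P (mat 1) = P (mat 1)"
    using P_eq[OF V, symmetric] P by (simp add: proj_subset_def qset_1)
  have "P (mat 1) $ i $ j = cadj (P (mat 1)) $ i $ j" for i j
  proof (cases "\<beta> i = \<beta> j")
    case True
    have "P (mat 1) $ i $ j = dagger \<beta> \<beta> P (mat 1) $ i $ j"
      using P by (simp add: proj_subset_def qset_1)
    also have "\<dots> = cadj (P (mat 1)) $ i $ j"
      using True block_size_nonzero[of \<beta> j] block_size_cong[OF True]
      by (simp add: dagger_nth P_eq[of "munit i j"] munit_qset qinner_mult_munit)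
    finally show ?thesis .
  next
    case False
    then show ?thesis using V by (auto simp: qset_def)
  qed
  then have "P (mat 1) = cadj (P (mat 1))" unfolding vec_eq_iff by blast
  then have "cadj (P (mat 1)) = P (mat 1)" by (rule sym)
  with V idem show "is_projection \<beta> (P (mat 1))"
    unfolding is_projection_def by blast
qed

lemma proj_subset_mult:
  assumes p: "is_projection \<beta> p"
  shows "proj_subset \<beta> (\<lambda>x. p ** x)"
proof -
  have pV: "p \<in> qset \<beta>" and pp: "p ** p = p" "cadj p = p"
    using p by (auto simp: is_projection_def)
  have "dagger \<beta> \<beta> (\<lambda>x. p ** x) a $ i $ j = (p ** a) $ i $ j" if "a \<in> qset \<beta>" for a i j
    using qset_mult[OF pV that] block_size_nonzero[of \<beta> j] block_size_cong[of \<beta> i j]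
    by (auto simp: dagger_nth qinner_mult_munit pp) (auto simp: qset_def)
  then show ?thesis
    using pV pp by (simp add: proj_subset_def clinear_on_def qset_mult matrix_add_ldistrib
        cscale_mult_right matrix_mul_assoc vec_eq_iff[of "dagger _ _ _ _"] vec_eq_iff[of "dagger _ _ _ _ $ _"])
qed

lemma disjoint_times_proj_iff:
  assumes p: "cadj (P (mat 1)) = P (mat 1)"
  shows "disjoint_rel (edge_proj \<beta> A) (times_proj P (compl_subset P)) \<longleftrightarrow>
    (\<forall>s\<in>op_space \<beta> A. (mat 1 - P (mat 1)) ** s ** P (mat 1) = 0)"
proof -
  let ?p = "P (mat 1)"
  have "hs_inner s (act (times_proj P (compl_subset P)) y) = hs_inner ((mat 1 - ?p) ** s ** ?p) y" for s y
    unfolding times_proj_def subset_proj_def compl_subset_def act_kron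
    by (subst hs_inner_mult_right, subst hs_inner_mult_left) (simp add: cadj_diff p matrix_mul_assoc)
  moreover have "(\<forall>y. hs_inner x y = 0) \<longleftrightarrow> x = 0" for x :: "complex^'a^'a"
    using hs_inner_self_eq_0 by (auto simp: hs_inner_eq)
  ultimately show ?thesis by (auto simp: disjoint_rel_def op_space_def)
qed

theorem disconnected_iff:
  assumes A: "quantum_graph \<beta> A" "undirected \<beta> A"
  shows "disconnected \<beta> A \<longleftrightarrow> (\<exists>p. separates \<beta> A p)"
proof
  assume "disconnected \<beta> A"
  then obtain P where P: "proj_subset \<beta> P" "nontrivial P"
    "disjoint_rel (edge_proj \<beta> A) (times_proj P (compl_subset P))"
    by (auto simp: disconnected_def)
  note proj = proj_subset_imp_projection(1)[OF P(1)]
  then have p: "cadj (P (mat 1)) = P (mat 1)" "P (mat 1) ** P (mat 1) = P (mat 1)"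
    by (auto simp: is_projection_def)
  have "\<forall>s\<in>op_space \<beta> A. s ** P (mat 1) = P (mat 1) ** s"
    using P(3) disjoint_times_proj_iff[of P \<beta> A, OF p(1)]
      commutes_iff_corner_eq_0(1)[OF cadj_op_space[OF A] p] by simp
  then show "\<exists>p. separates \<beta> A p"
    using proj P(2) by (auto simp: separates_def nontrivial_def subset_proj_def)
next
  assume "\<exists>p. separates \<beta> A p"
  then obtain p where sep: "is_projection \<beta> p" "p \<noteq> 0" "p \<noteq> mat 1"
    "\<forall>s\<in>op_space \<beta> A. s ** p = p ** s" by (auto simp: separates_def)
  then have p: "cadj p = p" "p ** p = p" by (auto simp: is_projection_def)
  have "disjoint_rel (edge_proj \<beta> A) (times_proj (\<lambda>x. p ** x) (compl_subset (\<lambda>x. p ** x)))"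
    using sep(4) disjoint_times_proj_iff[of "\<lambda>x. p ** x" \<beta> A] p
      commutes_iff_corner_eq_0(1)[OF cadj_op_space[OF A] p] by simp
  moreover have "nontrivial (\<lambda>x. p ** x)" using sep by (simp add: nontrivial_def subset_proj_def)
  ultimately show "disconnected \<beta> A"
    using proj_subset_mult[OF sep(1)] unfolding disconnected_def by blast
qed

section \<open>Classical functions to a classical set\<close>

lemma qinner_sum_left: "qinner \<beta> (\<Sum>a\<in>F. g a) y = (\<Sum>a\<in>F. qinner \<beta> (g a) y)"
  using qinner_sum[of \<beta> "\<lambda>_. 1" g F y] by simp

lemma qinner_add_right: "qinner \<beta> x (u + v) = qinner \<beta> x u + qinner \<beta> x v"
  and qinner_cscale_right: "qinner \<beta> x (c *\<^sub>C u) = c * qinner \<beta> x u"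
  and qinner_0_right: "qinner \<beta> x 0 = 0"
  by (simp_all add: qinner_eq algebra_simps sum.distrib sum_distrib_left)

lemma qinner_sum_right: "qinner \<beta> x (\<Sum>a\<in>F. c a *\<^sub>C g a) = (\<Sum>a\<in>F. c a * qinner \<beta> x (g a))"
  by (induction F rule: infinite_finite_induct)
    (simp_all add: qinner_add_right qinner_cscale_right qinner_0_right)

lemma qinner_self_eq_0:
  assumes "qinner \<beta> x x = 0"
  shows "x = 0"
proof -
  have "Re (qinner \<beta> x x) = (\<Sum>i\<in>UNIV. \<Sum>k\<in>UNIV. of_nat (block_size \<beta> i) * (cmod (x $ k $ i))\<^sup>2)"
    unfolding qinner_eq Re_sum
    by (intro sum.cong refl) (simp add: cmod_power2 flip: power2_eq_square)
  with assms have "\<forall>i k. x $ k $ i = 0"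
    by (simp add: sum_nonneg_eq_0_iff sum_nonneg block_size_nonzero)
  then show ?thesis by (simp add: vec_eq_iff)
qed

lemma qset_eqI_qinner:
  assumes u: "u \<in> qset \<beta>" and v: "v \<in> qset \<beta>"
    and eq: "\<And>x. x \<in> qset \<beta> \<Longrightarrow> qinner \<beta> u x = qinner \<beta> v x"
  shows "u = v"
proof -
  have "u $ i $ j = v $ i $ j" for i j
  proof (cases "\<beta> i = \<beta> j")
    case True
    with eq[of "munit i j"] show ?thesis
      by (simp add: munit_qset qinner_munit_right block_size_nonzero)
  next
    case False
    then show ?thesis using u v by (simp add: qset_def)
  qed
  then show ?thesis by (simp add: vec_eq_iff)
qed

lemma block_size_id: "block_size id i = 1"
  by (simp add: block_size_def)

text \<open>
The map whose component at the point \<open>e\<close> is the functional represented by \<open>r e\<close>; functions on the classical set are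
the diagonal matrices.
\<close>

definition classical_map ::
    "('n::finite \<Rightarrow> 'k) \<Rightarrow> ('m::finite \<Rightarrow> complex^'n^'n) \<Rightarrow> complex^'n^'n \<Rightarrow> complex^'m^'m"
  where "classical_map \<beta> r x = (\<chi> e e'. if e = e' then qinner \<beta> (r e) x else 0)"

definition projective_measurement :: "('n::finite \<Rightarrow> 'k) \<Rightarrow> ('m::finite \<Rightarrow> complex^'n^'n) \<Rightarrow> bool"
  where "projective_measurement \<beta> r \<longleftrightarrow> (\<forall>e. is_projection \<beta> (r e)) \<and>
    (\<forall>e e'. e \<noteq> e' \<longrightarrow> r e ** r e' = 0) \<and> (\<Sum>e\<in>UNIV. r e) = mat 1"

lemma clinear_on_classical_map: "clinear_on V (qset id) (classical_map \<beta> r)"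
  by (simp add: clinear_on_def classical_map_def qset_def vec_eq_iff qinner_add_right qinner_cscale_right)

lemma classical_map_munit_nth:
  assumes r: "cadj (r e) = r e" and ij: "\<beta> i = \<beta> j"
  shows "classical_map \<beta> r (munit i j) $ e $ e = of_nat (block_size \<beta> i) * r e $ j $ i"
proof -
  have "cnj (r e $ i $ j) = r e $ j $ i"
    using arg_cong[OF r, of "\<lambda>z. z $ j $ i"] by simp
  then show ?thesis
    using ij by (simp add: classical_map_def qinner_munit_right block_size_cong[OF ij])
qed

lemma sum_same_block:
  fixes \<beta> :: "'n::finite \<Rightarrow> 'k"
  shows "(\<Sum>(i, j)\<in>{(i, j). \<beta> i = \<beta> j}. g i j) = (\<Sum>i\<in>UNIV. \<Sum>j\<in>{j. \<beta> j = \<beta> i}. g i j)"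
proof -
  have "{(i, j). \<beta> i = \<beta> j} = Sigma UNIV (\<lambda>i. {j. \<beta> j = \<beta> i})" by auto
  then have "(\<Sum>(i, j)\<in>{(i, j). \<beta> i = \<beta> j}. g i j) =
      (\<Sum>(i, j)\<in>Sigma UNIV (\<lambda>i. {j. \<beta> j = \<beta> i}). g i j)" by (rule arg_cong)
  also have "\<dots> = (\<Sum>i\<in>UNIV. \<Sum>j\<in>{j. \<beta> j = \<beta> i}. g i j)"
    by (rule sum.Sigma[symmetric]) simp_all
  finally show ?thesis .
qed

text \<open>
The functionals \<open>\<langle>r\<^sub>a, \<cdot>\<rangle> \<otimes> \<langle>r\<^sub>b, \<cdot>\<rangle>\<close> compose with the comultiplication to \<open>\<langle>r\<^sub>a r\<^sub>b, \<cdot>\<rangle>\<close>, because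
the comultiplication is the adjoint of the multiplication.  On a classical set, compatibility of a map with
comultiplication therefore says \<open>r\<^sub>a r\<^sub>b = \<delta>\<^sub>a\<^sub>b r\<^sub>a\<close>.
\<close>

lemma tensor_classical_map_comult:
  assumes x: "x \<in> qset \<beta>" and r: "\<And>e. r e \<in> qset \<beta>" "\<And>e. cadj (r e) = r e"
  shows "tensor_map \<beta> \<beta> (classical_map \<beta> r) (classical_map \<beta> r) (comult \<beta> x) $ (a, b) $ (c, d) =
    (if a = c \<and> b = d then qinner \<beta> (r a ** r b) x else 0)"
proof (cases "a = c \<and> b = d")
  case True
  have summand: "comult \<beta> x $ (i, k) $ (j, l) *
      (classical_map \<beta> r (munit i j) $ a $ a * classical_map \<beta> r (munit k l) $ b $ b) =
      (if k = j then x $ i $ l * r a $ j $ i * (of_nat (block_size \<beta> l) * r b $ l $ k) else 0)"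
    if "\<beta> j = \<beta> i" "\<beta> l = \<beta> k" for i j k l
    using that block_size_nonzero[of \<beta> i] block_size_cong[of \<beta> l k]
    by (simp add: classical_map_munit_nth[OF r(2)] comult_nth)
  have "tensor_map \<beta> \<beta> (classical_map \<beta> r) (classical_map \<beta> r) (comult \<beta> x) $ (a, b) $ (a, b) =
    (\<Sum>i\<in>UNIV. \<Sum>j\<in>{j. \<beta> j = \<beta> i}. \<Sum>k\<in>UNIV. \<Sum>l\<in>{l. \<beta> l = \<beta> k}.
      if k = j then x $ i $ l * r a $ j $ i * (of_nat (block_size \<beta> l) * r b $ l $ k) else 0)"
    unfolding tensor_map_nth sum_same_block by (intro sum.cong refl) (rule summand; simp)
  also have "\<dots> = (\<Sum>i\<in>UNIV. \<Sum>j\<in>{j. \<beta> j = \<beta> i}. \<Sum>l\<in>UNIV.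
      x $ i $ l * r a $ j $ i * (of_nat (block_size \<beta> l) * r b $ l $ j))"
  proof (rule sum.cong[OF refl], rule sum.cong[OF refl])
    fix i j
    have "(\<Sum>k\<in>UNIV. \<Sum>l\<in>{l. \<beta> l = \<beta> k}.
        if k = j then x $ i $ l * r a $ j $ i * (of_nat (block_size \<beta> l) * r b $ l $ k) else 0) =
      (\<Sum>k\<in>UNIV. if k = j then \<Sum>l\<in>{l. \<beta> l = \<beta> j}.
        x $ i $ l * r a $ j $ i * (of_nat (block_size \<beta> l) * r b $ l $ j) else 0)"
      by (intro sum.cong refl) simp
    also have "\<dots> = (\<Sum>l\<in>{l. \<beta> l = \<beta> j}.
        x $ i $ l * r a $ j $ i * (of_nat (block_size \<beta> l) * r b $ l $ j))" by simp
    also have "\<dots> = (\<Sum>l\<in>UNIV. x $ i $ l * r a $ j $ i * (of_nat (block_size \<beta> l) * r b $ l $ j))"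
      using r(1)[of b] by (intro sum.mono_neutral_left) (auto simp: qset_def)
    finally show "(\<Sum>k\<in>UNIV. \<Sum>l\<in>{l. \<beta> l = \<beta> k}.
        if k = j then x $ i $ l * r a $ j $ i * (of_nat (block_size \<beta> l) * r b $ l $ k) else 0) =
      (\<Sum>l\<in>UNIV. x $ i $ l * r a $ j $ i * (of_nat (block_size \<beta> l) * r b $ l $ j))" .
  qed
  also have "\<dots> = (\<Sum>i\<in>UNIV. \<Sum>j\<in>UNIV. \<Sum>l\<in>UNIV.
      x $ i $ l * r a $ j $ i * (of_nat (block_size \<beta> l) * r b $ l $ j))"
    using r(1)[of a] by (intro sum.cong sum.mono_neutral_left refl) (auto simp: qset_def)
  also have "\<dots> = (\<Sum>i\<in>UNIV. \<Sum>l\<in>UNIV. \<Sum>j\<in>UNIV.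
      x $ i $ l * r a $ j $ i * (of_nat (block_size \<beta> l) * r b $ l $ j))"
    by (rule sum.cong[OF refl]) (rule sum.swap)
  also have "\<dots> = (\<Sum>l\<in>UNIV. \<Sum>i\<in>UNIV. \<Sum>j\<in>UNIV.
      x $ i $ l * r a $ j $ i * (of_nat (block_size \<beta> l) * r b $ l $ j))"
    by (rule sum.swap)
  also have "\<dots> = (\<Sum>l\<in>UNIV. \<Sum>i\<in>UNIV. of_nat (block_size \<beta> l) * (cnj ((r a ** r b) $ i $ l) * x $ i $ l))"
  proof -
    have "cnj ((r a ** r b) $ i $ l) = (\<Sum>j\<in>UNIV. r b $ l $ j * r a $ j $ i)" for i l
    proof -
      have "cnj ((r a ** r b) $ i $ l) = cadj (r a ** r b) $ l $ i" by simp
      also have "\<dots> = (r b ** r a) $ l $ i" by (simp only: cadj_mult r(2))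
      finally show ?thesis by (simp add: matrix_mult_nth)
    qed
    then show ?thesis
      by (intro sum.cong refl) (simp add: sum_distrib_left sum_distrib_right mult_ac)
  qed
  also have "\<dots> = qinner \<beta> (r a ** r b) x" by (simp add: qinner_eq)
  finally show ?thesis using True by simp
next
  case False
  then have "classical_map \<beta> r y $ a $ c = 0 \<or> classical_map \<beta> r z $ b $ d = 0" for y z
    by (auto simp: classical_map_def)
  then show ?thesis using False by (auto simp: tensor_map_nth intro!: sum.neutral)
qed

lemma tensor_map_cong:
  assumes "\<And>x. x \<in> qset \<beta> \<Longrightarrow> f x = f' x" "\<And>x. x \<in> qset \<gamma> \<Longrightarrow> g x = g' x"
  shows "tensor_map \<beta> \<gamma> f g w = tensor_map \<beta> \<gamma> f' g' w"
  unfolding tensor_map_def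
  by (intro sum.cong refl) (auto simp: munit_qset assms intro!: sum.cong)

lemma comult_id_nth: "comult id y $ (a, b) $ (c, d) = (if a = c \<and> b = d then if a = b then y $ a $ a else 0 else 0)"
  by (auto simp: comult_nth block_size_id)

lemma counit_classical_map: "counit id (classical_map \<beta> r x) = qinner \<beta> (\<Sum>e\<in>UNIV. r e) x"
  by (simp add: counit_def qinner_def[of id] block_size_id classical_map_def qinner_sum_left)

lemma classical_function_classical_map:
  assumes r: "projective_measurement \<beta> r"
  shows "classical_function \<beta> id (classical_map \<beta> r)"
proof -
  have V: "\<And>e. r e \<in> qset \<beta>" and adj: "\<And>e. cadj (r e) = r e" and idem: "\<And>e. r e ** r e = r e"
    and orth: "\<And>e e'. e \<noteq> e' \<Longrightarrow> r e ** r e' = 0" and sum: "(\<Sum>e\<in>UNIV. r e) = mat 1"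
    using r by (auto simp: projective_measurement_def is_projection_def)
  have q0: "qinner \<beta> 0 x = 0" for x using qinner_sum_left[of \<beta> _ "{}" x] by simp
  have "comult id (classical_map \<beta> r x) =
      tensor_map \<beta> \<beta> (classical_map \<beta> r) (classical_map \<beta> r) (comult \<beta> x)" if "x \<in> qset \<beta>" for x
  proof -
    have "comult id (classical_map \<beta> r x) $ (a, b) $ (c, d) =
      tensor_map \<beta> \<beta> (classical_map \<beta> r) (classical_map \<beta> r) (comult \<beta> x) $ (a, b) $ (c, d)" for a b c d
      unfolding tensor_classical_map_comult[OF that V adj] comult_id_nth
      by (auto simp: idem orth q0 classical_map_def)
    then show ?thesis by (simp add: vec_eq_iff)
  qed
  moreover have "classical_map \<beta> r (cadj x) = cadj (classical_map \<beta> r x)" if x: "x \<in> qset \<beta>" for x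
  proof -
    have "qinner \<beta> (r e) (cadj x) = cnj (qinner \<beta> (r e) x)" for e
    proof -
      have re: "cnj (r e $ k $ i) = r e $ i $ k" for i k
        using arg_cong[OF adj[of e], of "\<lambda>z. z $ i $ k"] by simp
      have "qinner \<beta> (r e) (cadj x) = (\<Sum>k\<in>UNIV. \<Sum>i\<in>UNIV. of_nat (block_size \<beta> i) * (r e $ i $ k * cnj (x $ i $ k)))"
        unfolding qinner_eq by (subst sum.swap) (simp add: re)
      also have "\<dots> = (\<Sum>k\<in>UNIV. \<Sum>i\<in>UNIV. of_nat (block_size \<beta> k) * (r e $ i $ k * cnj (x $ i $ k)))"
      proof (intro sum.cong refl)
        fix k i
        show "of_nat (block_size \<beta> i) * (r e $ i $ k * cnj (x $ i $ k)) =
          of_nat (block_size \<beta> k) * (r e $ i $ k * cnj (x $ i $ k))"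
        proof (cases "\<beta> i = \<beta> k")
          case True then show ?thesis by (simp add: block_size_cong[OF True])
        next
          case False then show ?thesis using x by (simp add: qset_def)
        qed
      qed
      also have "\<dots> = cnj (qinner \<beta> (r e) x)" by (simp add: qinner_eq)
      finally show ?thesis .
    qed
    then show ?thesis by (simp add: vec_eq_iff classical_map_def)
  qed
  ultimately show ?thesis
    by (simp add: classical_function_def clinear_on_classical_map counit_classical_map sum)
      (simp add: counit_def)
qed

text \<open>
Each component of \<open>\<phi>\<close> is a linear functional, represented by a matrix \<open>r e\<close> in the quantum set.  Reality of \<open>\<phi>\<close> makes
\<open>r e\<close> self-adjoint, comultiplicativity makes the family idempotent and orthogonal, and
preservation of the counit makes it sum to the identity.
\<close>

lemma classical_function_imp_measurement:
  fixes \<phi> :: "complex^'n^'n \<Rightarrow> complex^'m^'m"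
  assumes \<phi>: "classical_function \<beta> id \<phi>"
  obtains r where "projective_measurement \<beta> r" "\<And>x. x \<in> qset \<beta> \<Longrightarrow> \<phi> x = classical_map \<beta> r x"
proof -
  have lin: "clinear_on (qset \<beta>) (qset id) \<phi>" using \<phi> by (simp add: classical_function_def)
  define r :: "'m \<Rightarrow> complex^'n^'n" where "r e = (\<chi> i j. if \<beta> i = \<beta> j
    then cnj (\<phi> (munit i j) $ e $ e) / of_nat (block_size \<beta> i) else 0)" for e
  have V: "r e \<in> qset \<beta>" for e by (simp add: r_def qset_def)
  have adj: "cadj (r e) = r e" for e
  proof -
    have "cnj (\<phi> (munit i j) $ e $ e) = \<phi> (munit j i) $ e $ e" if "\<beta> i = \<beta> j" for i j
    proof -
      have "\<phi> (cadj (munit i j)) = cadj (\<phi> (munit i j))"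
        using \<phi> that unfolding classical_function_def by (simp add: munit_qset del: cadj_munit)
      then show ?thesis by simp
    qed
    then have "cadj (r e) $ i $ j = r e $ i $ j" for i j
      by (auto simp: r_def block_size_cong[of \<beta> i j])
    then show ?thesis unfolding vec_eq_iff by blast
  qed
  have eq_munit: "\<phi> (munit i j) = classical_map \<beta> r (munit i j)" if "\<beta> i = \<beta> j" for i j
  proof -
    have "\<phi> (munit i j) $ e $ e' = classical_map \<beta> r (munit i j) $ e $ e'" for e e'
    proof (cases "e = e'")
      case True
      then show ?thesis using that block_size_nonzero[of \<beta> j]
        by (simp add: classical_map_def qinner_munit_right r_def block_size_cong[OF that])
    next
      case False
      have "\<phi> (munit i j) \<in> qset id"
        using that by (intro clinear_on_closed[OF lin]) (simp add: munit_qset)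
      then show ?thesis using False by (simp add: qset_def classical_map_def)
    qed
    then show ?thesis unfolding vec_eq_iff by blast
  qed
  have eq: "\<phi> x = classical_map \<beta> r x" if "x \<in> qset \<beta>" for x
    unfolding clinear_on_expand[OF lin that] clinear_on_expand[OF clinear_on_classical_map that]
    by (intro sum.cong refl) (auto simp: eq_munit)
  have mult: "(if a = b then qinner \<beta> (r a) x else 0) = qinner \<beta> (r a ** r b) x" if x: "x \<in> qset \<beta>" for a b x
  proof -
    have "comult id (\<phi> x) = tensor_map \<beta> \<beta> \<phi> \<phi> (comult \<beta> x)"
      using \<phi> x by (simp add: classical_function_def)
    also have "\<dots> = tensor_map \<beta> \<beta> (classical_map \<beta> r) (classical_map \<beta> r) (comult \<beta> x)"
      by (rule tensor_map_cong) (rule eq, assumption)+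
    finally have "comult id (classical_map \<beta> r x) $ (a, b) $ (a, b) = qinner \<beta> (r a ** r b) x"
      by (simp add: eq[OF x] tensor_classical_map_comult[OF x V adj])
    then show ?thesis by (auto simp: comult_id_nth classical_map_def split: if_splits)
  qed
  have "r e ** r e = r e" for e
    by (rule qset_eqI_qinner[of _ \<beta>]) (use V mult[of _ e e] in \<open>auto intro: qset_mult\<close>)
  moreover have "r e ** r e' = 0" if "e \<noteq> e'" for e e'
  proof (rule qset_eqI_qinner[of _ \<beta>])
    show "qinner \<beta> (r e ** r e') x = qinner \<beta> 0 x" if "x \<in> qset \<beta>" for x
      using mult[OF that, of e e'] \<open>e \<noteq> e'\<close> by (simp add: qinner_eq[of _ 0])
  qed (use V in \<open>auto intro: qset_mult simp: cmat.subspace_0[OF subspace_qset]\<close>)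
  moreover have "(\<Sum>e\<in>UNIV. r e) = mat 1"
  proof (rule qset_eqI_qinner[of _ \<beta>])
    show "(\<Sum>e\<in>UNIV. r e) \<in> qset \<beta>" by (rule cmat.subspace_sum[OF subspace_qset]) (rule V)
    show "qinner \<beta> (\<Sum>e\<in>UNIV. r e) x = qinner \<beta> (mat 1) x" if "x \<in> qset \<beta>" for x
    proof -
      have "counit id (\<phi> x) = counit \<beta> x" using \<phi> that by (simp add: classical_function_def)
      then show ?thesis by (simp add: eq[OF that] counit_classical_map) (simp add: counit_def)
    qed
  qed (rule qset_1)
  ultimately have "projective_measurement \<beta> r"
    using V adj by (simp add: projective_measurement_def is_projection_def)
  then show thesis using eq by (rule that)
qed

text \<open>
The \<open>r e\<close> are pairwise orthogonal also for the inner product of the quantum set, so when they are non-zero the values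
of the components can be prescribed by a combination of the \<open>r e\<close>.
\<close>

lemma classical_map_surj_iff:
  assumes r: "projective_measurement \<beta> r"
  shows "classical_map \<beta> r ` qset \<beta> = qset id \<longleftrightarrow> (\<forall>e. r e \<noteq> 0)"
proof
  assume surj: "classical_map \<beta> r ` qset \<beta> = qset id"
  show "\<forall>e. r e \<noteq> 0"
  proof
    fix e
    have "munit e e \<in> classical_map \<beta> r ` qset \<beta>" unfolding surj by (simp add: munit_qset)
    then obtain x where "classical_map \<beta> r x $ e $ e = munit e e $ e $ e" by auto
    then have "qinner \<beta> (r e) x = 1" by (simp add: classical_map_def munit_nth)
    then show "r e \<noteq> 0" by (auto simp: qinner_eq)
  qed
next
  assume nz: "\<forall>e. r e \<noteq> 0"
  have orth: "qinner \<beta> (r e) (r e') = 0" if "e \<noteq> e'" for e e'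
    using r that by (simp add: qinner_def projective_measurement_def is_projection_def)
  have "y \<in> classical_map \<beta> r ` qset \<beta>" if y: "y \<in> qset id" for y
  proof -
    define x where "x = (\<Sum>e\<in>UNIV. (y $ e $ e / qinner \<beta> (r e) (r e)) *\<^sub>C r e)"
    have "x \<in> qset \<beta>" unfolding x_def
      using r by (intro cmat.subspace_sum[OF subspace_qset] cmat.subspace_scale[OF subspace_qset])
        (simp add: projective_measurement_def is_projection_def)
    moreover have "qinner \<beta> (r e) x = y $ e $ e" for e
    proof -
      have "qinner \<beta> (r e) x = (\<Sum>e'\<in>UNIV. if e' = e then y $ e $ e else 0)"
        unfolding x_def qinner_sum_right
        using nz orth qinner_self_eq_0[of \<beta> "r e"] by (intro sum.cong refl) auto
      then show ?thesis by simp
    qed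
    then have "y = classical_map \<beta> r x"
      using y by (auto simp: vec_eq_iff classical_map_def qset_def)
    ultimately show ?thesis by blast
  qed
  then show "classical_map \<beta> r ` qset \<beta> = qset id"
    using clinear_on_closed[OF clinear_on_classical_map] by blast
qed

section \<open>Homomorphisms to a graph of isolated loops\<close>

lemma edge_op_id_nth:
  "edge_op id id w $ (a, b) $ (c, d) = (if a = b \<and> a = c \<and> b = d then w $ (a, a) $ (a, a) else 0)"
proof -
  have "clinear_on (qset id) (qset id) (id :: complex^'a^'a \<Rightarrow> complex^'a^'a)"
    by (simp add: clinear_on_def)
  from edge_op_nth[OF this, of w a b c d]
  have "edge_op id id w $ (a, b) $ (c, d) =
      (if a = c then if b = c \<and> d = a then w $ (a, d) $ (d, d) else 0 else 0)"
    by (simp add: block_size_id cong: if_cong)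
  then show ?thesis by auto
qed

lemma edge_img_id:
  "t \<in> edge_img id id \<longleftrightarrow> t \<in> qset (sq id) \<and> (\<forall>a b. a \<noteq> b \<longrightarrow> t $ (a, b) $ (a, b) = 0)"
proof
  assume "t \<in> edge_img id id"
  then show "t \<in> qset (sq id) \<and> (\<forall>a b. a \<noteq> b \<longrightarrow> t $ (a, b) $ (a, b) = 0)"
    by (auto simp: edge_img_def qset_def edge_op_id_nth)
next
  assume t: "t \<in> qset (sq id) \<and> (\<forall>a b. a \<noteq> b \<longrightarrow> t $ (a, b) $ (a, b) = 0)"
  then have "t $ (a, b) $ (c, d) = edge_op id id t $ (a, b) $ (c, d)" for a b c d
    by (cases "a = c \<and> b = d") (auto simp: qset_def edge_op_id_nth)
  then have "t = edge_op id id t" by (simp add: vec_eq_iff)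
  then show "t \<in> edge_img id id" using t unfolding edge_img_def by (metis imageI)
qed

text \<open>
The projection \<open>r e\<close> moves into the argument of \<open>A\<close> and \<open>r e'\<close> becomes a factor on the left.  So the
off-diagonal entries of the image of the edge relation are the entries of \<open>r\<^sub>e\<^sub>' A(r\<^sub>e x)\<close>.
\<close>

lemma tensor_classical_map_edge_op:
  assumes A: "clinear_on (qset \<beta>) (qset \<beta>) A"
    and r: "\<And>e. r e \<in> qset \<beta>" "\<And>e. cadj (r e) = r e" and ij: "\<beta> i = \<beta> j" and kl: "\<beta> k = \<beta> l"
  shows "tensor_map \<beta> \<beta> (classical_map \<beta> r) (classical_map \<beta> r)
      (edge_op \<beta> A (kron (munit i j) (munit k l))) $ (e, e') $ (e, e') =
    of_nat (block_size \<beta> l) * (r e' ** A (r e ** munit i j)) $ l $ k"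
proof -
  let ?bs = "\<lambda>i. of_nat (block_size \<beta> i) :: complex"
  have "tensor_map \<beta> \<beta> (classical_map \<beta> r) (classical_map \<beta> r)
      (edge_op \<beta> A (kron (munit i j) (munit k l))) $ (e, e') $ (e, e') =
    (\<Sum>a\<in>UNIV. \<Sum>c\<in>{c. \<beta> c = \<beta> a}. \<Sum>b\<in>UNIV. \<Sum>d\<in>{d. \<beta> d = \<beta> b}.
      if a = i then if d = l then r e $ c $ i * A (munit c j) $ b $ k * (?bs l * r e' $ l $ b) else 0 else 0)"
    unfolding tensor_map_nth sum_same_block edge_op_kron_munit[OF A ij kl]
  proof (intro sum.cong refl, goal_cases)
    case (1 a c b d)
    then show ?case
      using block_size_nonzero[of \<beta> i] block_size_cong[of \<beta> d b]
      by (auto simp: classical_map_munit_nth[OF r(2)])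
  qed
  also have "\<dots> = (\<Sum>a\<in>UNIV. if a = i then \<Sum>c\<in>{c. \<beta> c = \<beta> i}. \<Sum>b\<in>UNIV. \<Sum>d\<in>{d. \<beta> d = \<beta> b}.
      if d = l then r e $ c $ i * A (munit c j) $ b $ k * (?bs l * r e' $ l $ b) else 0 else 0)"
    by (intro sum.cong refl) simp
  also have "\<dots> = (\<Sum>c\<in>{c. \<beta> c = \<beta> i}. \<Sum>b\<in>UNIV. \<Sum>d\<in>{d. \<beta> d = \<beta> b}.
      if d = l then r e $ c $ i * A (munit c j) $ b $ k * (?bs l * r e' $ l $ b) else 0)" by simp
  also have "\<dots> = (\<Sum>c\<in>{c. \<beta> c = \<beta> i}. \<Sum>b\<in>UNIV. r e $ c $ i * A (munit c j) $ b $ k * (?bs l * r e' $ l $ b))"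
    using r(1)[of e'] by (intro sum.cong refl) (auto simp: qset_def)
  also have "\<dots> = (\<Sum>b\<in>UNIV. \<Sum>c\<in>{c. \<beta> c = \<beta> i}. r e $ c $ i * A (munit c j) $ b $ k * (?bs l * r e' $ l $ b))"
    by (rule sum.swap)
  also have "\<dots> = ?bs l * (r e' ** A (r e ** munit i j)) $ l $ k"
    using ij by (simp add: matrix_mult_nth[of "r e'"] clinear_on_mult_munit_nth[OF A r(1)]
        sum_distrib_left mult_ac)
  finally show ?thesis .
qed

lemma edge_op_tensor_expand:
  assumes "w \<in> qset (sq \<beta>)"
  shows "tensor_map \<beta> \<beta> f g (edge_op \<beta> A w) =
    (\<Sum>((i, k), (j, l))\<in>{(p, q). sq \<beta> p = sq \<beta> q}. (w $ (i, k) $ (j, l)) *\<^sub>C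
       tensor_map \<beta> \<beta> f g (edge_op \<beta> A (kron (munit i j) (munit k l))))"
proof -
  have munit_kron: "munit s t = kron (munit (fst s) (fst t)) (munit (snd s) (snd t))" for s t :: "'a \<times> 'a"
    by (auto simp: vec_eq_iff kron_def munit_nth prod_eq_iff)
  have "w = (\<Sum>s\<in>{(p, q). sq \<beta> p = sq \<beta> q}. (w $ fst s $ snd s) *\<^sub>C
      kron (munit (fst (fst s)) (fst (snd s))) (munit (snd (fst s)) (snd (snd s))))"
    using qset_expand[OF assms] unfolding case_prod_unfold munit_kron .
  then have "edge_op \<beta> A w = edge_op \<beta> A (\<Sum>s\<in>{(p, q). sq \<beta> p = sq \<beta> q}. (w $ fst s $ snd s) *\<^sub>C
      kron (munit (fst (fst s)) (fst (snd s))) (munit (snd (fst s)) (snd (snd s))))"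
    by (rule arg_cong)
  also have "\<dots> = (\<Sum>s\<in>{(p, q). sq \<beta> p = sq \<beta> q}. (w $ fst s $ snd s) *\<^sub>C
      edge_op \<beta> A (kron (munit (fst (fst s)) (fst (snd s))) (munit (snd (fst s)) (snd (snd s)))))"
    by (rule edge_op_sum)
  finally show ?thesis by (simp add: tensor_map_sum case_prod_unfold)
qed

lemma graph_hom_classical_iff:
  fixes r :: "'m::finite \<Rightarrow> complex^'n^'n"
  assumes A: "clinear_on (qset \<beta>) (qset \<beta>) A" and r: "projective_measurement \<beta> r"
  shows "graph_hom \<beta> A id id (classical_map \<beta> r) \<longleftrightarrow>
    (\<forall>e e'. e \<noteq> e' \<longrightarrow> (\<forall>x\<in>qset \<beta>. r e' ** A (r e ** x) = 0))"
proof -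
  have V: "\<And>e. r e \<in> qset \<beta>" and adj: "\<And>e. cadj (r e) = r e"
    using r by (auto simp: projective_measurement_def is_projection_def)
  let ?T = "tensor_map \<beta> \<beta> (classical_map \<beta> r) (classical_map \<beta> r)"
  have "?T w \<in> qset (sq id)" for w
    by (auto simp: qset_def tensor_map_nth classical_map_def case_prod_unfold)
  then have "graph_hom \<beta> A id id (classical_map \<beta> r) \<longleftrightarrow>
      (\<forall>e e'. e \<noteq> e' \<longrightarrow> (\<forall>w\<in>qset (sq \<beta>). ?T (edge_op \<beta> A w) $ (e, e') $ (e, e') = 0))"
    unfolding graph_hom_def edge_img_def[of \<beta>] image_subset_iff edge_img_id
    using classical_function_classical_map[OF r] by auto
  also have "\<dots> \<longleftrightarrow> (\<forall>e e'. e \<noteq> e' \<longrightarrow> (\<forall>x\<in>qset \<beta>. r e' ** A (r e ** x) = 0))"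
  proof (intro all_cong1 imp_cong refl)
    fix e e' :: 'm
    note kron = tensor_classical_map_edge_op[where r = r, OF A V adj]
    show "(\<forall>w\<in>qset (sq \<beta>). ?T (edge_op \<beta> A w) $ (e, e') $ (e, e') = 0) \<longleftrightarrow>
      (\<forall>x\<in>qset \<beta>. r e' ** A (r e ** x) = 0)"
    proof
      assume T0: "\<forall>w\<in>qset (sq \<beta>). ?T (edge_op \<beta> A w) $ (e, e') $ (e, e') = 0"
      show "\<forall>x\<in>qset \<beta>. r e' ** A (r e ** x) = 0"
      proof
        fix x assume x: "x \<in> qset \<beta>"
        have unit: "r e' ** A (r e ** munit i j) = 0" if ij: "\<beta> i = \<beta> j" for i j
        proof -
          have AV: "r e' ** A (r e ** munit i j) \<in> qset \<beta>"
            using ij by (intro qset_mult V clinear_on_closed[OF A]) (simp add: munit_qset)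
          have "(r e' ** A (r e ** munit i j)) $ l $ k = 0" for l k
          proof (cases "\<beta> k = \<beta> l")
            case True
            have "kron (munit i j) (munit k l) \<in> qset (sq \<beta>)"
              using ij True by (auto simp: qset_def kron_def munit_nth)
            then show ?thesis
              using T0 kron[OF ij True, of e e'] by (simp add: block_size_nonzero)
          next
            case False
            then show ?thesis using AV by (auto simp: qset_def)
          qed
          then show ?thesis by (simp add: vec_eq_iff)
        qed
        have "clinear_on (qset \<beta>) UNIV (\<lambda>x. r e' ** A (r e ** x))"
          by (simp add: clinear_on_def matrix_add_ldistrib cscale_mult_right qset_mult V
              clinear_on_add[OF A] clinear_on_cscale[OF A])
        from clinear_on_expand[OF this x] show "r e' ** A (r e ** x) = 0"
          by (auto simp: unit intro!: sum.neutral)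
      qed
    next
      assume "\<forall>x\<in>qset \<beta>. r e' ** A (r e ** x) = 0"
      then show "\<forall>w\<in>qset (sq \<beta>). ?T (edge_op \<beta> A w) $ (e, e') $ (e, e') = 0"
        by (auto simp: edge_op_tensor_expand sum_matrix_nth kron munit_qset intro!: sum.neutral)
    qed
  qed
  finally show ?thesis .
qed

lemma graph_hom_cong:
  assumes "\<And>x. x \<in> qset \<beta> \<Longrightarrow> \<phi> x = \<psi> x"
  shows "graph_hom \<beta> A \<gamma> B \<phi> \<Longrightarrow> classical_function \<beta> \<gamma> \<psi> \<Longrightarrow> graph_hom \<beta> A \<gamma> B \<psi>"
  unfolding graph_hom_def using tensor_map_cong[of \<beta> \<phi> \<psi> \<beta> \<phi> \<psi>] assms by simp

text \<open>
On the two-point set a projective measurement is a pair \<open>p, 1 - p\<close>, with \<open>p\<close> the projection at the point \<open>1\<close>.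
\<close>

theorem not_matsuda_connected_iff:
  assumes A: "quantum_graph \<beta> A" "undirected \<beta> A"
  shows "\<not> matsuda_connected \<beta> A \<longleftrightarrow> (\<exists>p. separates \<beta> A p)"
proof
  have lin: "clinear_on (qset \<beta>) (qset \<beta>) A" using A by (simp add: quantum_graph_def)
  {
    assume "\<not> matsuda_connected \<beta> A"
    then obtain \<phi> where hom: "graph_hom \<beta> A id id \<phi>" and surj: "\<phi> ` qset \<beta> = qset (id :: 2 \<Rightarrow> 2)"
      by (auto simp: matsuda_connected_def two_blocks_def two_loops_def)
    from hom have "classical_function \<beta> id \<phi>" by (simp add: graph_hom_def)
    then obtain r where r: "projective_measurement \<beta> r"
      and eq: "\<And>x. x \<in> qset \<beta> \<Longrightarrow> \<phi> x = classical_map \<beta> r x"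
      using classical_function_imp_measurement by metis
    have "graph_hom \<beta> A id id (classical_map \<beta> r)"
      using graph_hom_cong[OF eq hom] classical_function_classical_map[OF r] by blast
    then have edge: "\<forall>x\<in>qset \<beta>. r 2 ** A (r 1 ** x) = 0"
      unfolding graph_hom_classical_iff[OF lin r] by simp
    have "classical_map \<beta> r ` qset \<beta> = qset id" using surj eq by simp
    then have nz: "r e \<noteq> 0" for e unfolding classical_map_surj_iff[OF r] by blast
    have "r 1 + r 2 = mat 1" using r by (simp add: projective_measurement_def sum_2)
    then have r2: "r 2 = mat 1 - r 1" by (simp add: algebra_simps)
    have proj: "is_projection \<beta> (r 1)" using r by (simp add: projective_measurement_def)
    have "separates \<beta> A (r 1)"
      unfolding separates_def using proj nz[of 1] nz[of 2] edge separates_iff_edges(1)[OF A proj]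
      by (auto simp: r2)
    then show "\<exists>p. separates \<beta> A p" ..
  }
  assume "\<exists>p. separates \<beta> A p"
  then obtain p where p: "is_projection \<beta> p" "p \<noteq> 0" "p \<noteq> mat 1"
    "\<forall>s\<in>op_space \<beta> A. s ** p = p ** s" by (auto simp: separates_def)
  define r :: "2 \<Rightarrow> complex^'a^'a" where "r e = (if e = 1 then p else mat 1 - p)" for e
  have r12: "r 1 = p" "r 2 = mat 1 - p" by (simp_all add: r_def)
  have proj: "is_projection \<beta> (mat 1 - p)"
    using p(1) by (simp add: is_projection_def qset_1 qset_diff cadj_diff
        matrix_diff_ldistrib matrix_diff_rdistrib)
  have r: "projective_measurement \<beta> r"
    unfolding projective_measurement_def forall_2 r12
    using p(1) proj by (simp add: sum_2 r12 is_projection_def matrix_diff_ldistrib matrix_diff_rdistrib)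
  have "graph_hom \<beta> A id id (classical_map \<beta> r)"
    unfolding graph_hom_classical_iff[OF lin r] forall_2 r12
    using p(4) separates_iff_edges[OF A p(1)] by simp
  moreover have "classical_map \<beta> r ` qset \<beta> = qset id"
    unfolding classical_map_surj_iff[OF r] forall_2 r12 using p(2,3) by simp
  ultimately show "\<not> matsuda_connected \<beta> A"
    unfolding matsuda_connected_def two_blocks_def two_loops_def by blast
qed

theorem theorem4p14:
  fixes \<beta> :: "'n::finite \<Rightarrow> 'k"
    and A :: "complex^'n^'n \<Rightarrow> complex^'n^'n"
  assumes "quantum_graph \<beta> A"
    and "undirected \<beta> A"
    and "loopless \<beta> A"
  shows "(\<not> cgw_connected \<beta> A \<longleftrightarrow> \<not> cds_connected \<beta> A) \<and>
         (\<not> cds_connected \<beta> A \<longleftrightarrow> \<not> matsuda_connected \<beta> A) \<and>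
         (\<not> matsuda_connected \<beta> A \<longleftrightarrow> disconnected \<beta> A)"
  using not_cgw_connected_iff[OF assms(1,2)] not_cds_connected_iff[OF assms(1,2)]
    not_matsuda_connected_iff[OF assms(1,2)] disconnected_iff[OF assms(1,2)] by blast

end
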